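(* For every $x\in\mathbb{Z}^2\cap H$, the point $\Psi(x)$ lies in one of the open polygons $P_1,\dots,P_{26}$ of $\mathcal{P}$, and the polygon containing $\Psi(x)$ determines the local type of $x$ in the arithmetic graph $\Gamma$: if $\Psi(x)\in P_k$ then $x$ has local type $T_k$. Consequently $x$ has a given local type $\tau$ if and only if $\Psi(x)$ lies in some $P_k$ with $T_k=\tau$.
   Context: $\phi=(1+\sqrt5)/2$, $A=\phi^{-3}$, $\mathbb{T}^2=\mathbb{R}^2/\mathbb{Z}^2$, $[\,\cdot\,]$ is projection to $\mathbb{T}^2$. Dynamics. $S$ is the convex quadrilateral with vertices $(0,1),(-1,0),(0,-1),(A,0)$. The outer billiards map sends $x_0\in\mathbb{R}^2-S$ to the point $x_1$ such that $\overline{x_0x_1}$ is tangent to $S$ at its midpoint (a vertex of $S$) and $S$ lies to the right of the ray $\overrightarrow{x_0x_1}$. $\Upsilon$ is its square. Let $T(x,y)=2Ax+2y+\frac{1-A}{2}$ and $\mathcal{C}(\pm)=\big(T(\mathbb{Z}^2)\cap(0,\infty)\big)\times\{\pm1\}$ (both signs). All iterates of $\Upsilon$ are defined on $\mathcal{C}(\pm)$, and $\Upsilon_R:\mathcal{C}(\pm)\to\mathcal{C}(\pm)$ is the first return map of $\Upsilon$. Arithmetic graph. $H=\{z\in\mathbb{R}^2:T(z)>0\}$. The arithmetic graph $\Gamma\subset H$ has vertices in $\mathbb{Z}^2\cap H$; distinct $x_1,x_2\in\mathbb{Z}^2\cap H$ are joined by a segment iff there are $\epsilon_1,\epsilon_2\in\{-1,1\}$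 with $\Upsilon_R(T(x_1),\epsilon_1)=(T(x_2),\epsilon_2)$ (this relation is symmetric). The local type of $x\in \mathbb{Z}^2\cap H$ is the translation class of the union of the edges emanating from $x$; it is recorded by the set of vectors $x'-x$ with $x'$ joined to $x$. Types: $T_1=\{(1,1),(0,1)\}$, $T_3=\{(-1,1),(1,1)\}$, $T_5=T_7=\{(-1,1),(0,-1)\}$, $T_9=\{(0,1),(-1,-1)\}$, $T_{11}=T_{13}=\{(1,1),(-1,0)\}$, $T_{15}=T_{17}=\{(0,-1),(-1,0)\}$, $T_{19}=\{(0,1),(-1,0)\}$, $T_{21}=T_{23}=\{(0,1),(0,-1)\}$; $T_{2j}=-T_{2j-1}$ for $j=1,\dots,11$; $T_{24}=T_{25}=T_{26}=\emptyset$ (no edges). The map: $\Psi:\mathbb{Z}^2\to\mathbb{T}^2$, $\Psi(x,y)=\big[\big(\frac{T(x,y)}{2\phi},\frac{T(x,y)}{2}\big)\big]=\big[(\phi^{-4}x+\phi^{-1}y,\ \phi^{-3}x)+\frac12(\phi^{-3},\phi^{-2})\big]$. The partition $\mathcal{P}$ of $\mathbb{T}^2$: write $\langle a_0,a_1,a_2,a_3\rangle$ for the point $\big(\frac{a_0+a_1\phi}{2},\frac{a_2+a_3\phi}{2}\big)$. $P_k$ is the projection to $\mathbb{T}^2$ of the interior of the convex hull of the following points: $P_1$: $\langle5,-3,0,0\rangle,\langle10,-6,-6,4\rangle,\langle2,-1,0,0\rangle$; $P_3$: $\langle0,0,0,0\rangle,\langle5,-3,0,0\rangle,\langle10,-6,-6,4\rangle,\langle5,-3,-6,4\rangle$;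 $P_5$: $\langle0,0,0,0\rangle,\langle13,-8,-6,4\rangle,\langle5,-3,-6,4\rangle$; $P_7$: $\langle9,-5,-4,4\rangle,\langle4,-2,2,0\rangle,\langle1,0,2,0\rangle,\langle14,-8,-4,4\rangle$; $P_9$: $\langle3,-2,-4,2\rangle,\langle-5,3,2,-2\rangle,\langle3,-2,-2,0\rangle,\langle-2,1,-2,0\rangle,\langle6,-4,-8,4\rangle$; $P_{11}$: $\langle0,0,0,0\rangle,\langle5,-3,-4,2\rangle,\langle-3,2,0,0\rangle$; $P_{13}$: $\langle10,-6,-6,4\rangle,\langle5,-3,-6,4\rangle,\langle-3,2,4,-2\rangle$; $P_{15}$: $\langle13,-8,-6,4\rangle,\langle5,-3,-6,4\rangle,\langle-3,2,4,-2\rangle,\langle5,-3,-2,2\rangle$; $P_{17}$: $\langle12,-8,-8,4\rangle,\langle7,-5,-8,4\rangle,\langle4,-3,-4,2\rangle$; $P_{19}$: $\langle-4,2,-2,0\rangle,\langle1,-1,-2,0\rangle,\langle4,-3,-6,2\rangle$; $P_{21}$: $\langle1,-1,0,0\rangle,\langle6,-4,-6,4\rangle,\langle-2,1,0,0\rangle$; $P_{23}$: $\langle6,-3,-2,2\rangle,\langle-2,2,2,0\rangle,\langle-4,3,4,-2\rangle,\langle4,-2,0,0\rangle$; $P_{24}$: $\langle1,-1,0,0\rangle,\langle-2,1,0,0\rangle,\langle3,-2,-4,2\rangle,\langle1,-1,-2,0\rangle,\langle-1,0,-2,0\rangle,\langle4,-3,-4,2\rangle$; $P_{26}$: $\langle0,0,0,0\rangle,\langle5,-3,-4,2\rangle,\langle0,0,-2,0\rangle,\langle-5,3,2,-2\rangle$;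 and $P_{2j}=-P_{2j-1}$ for $j=1,\dots,11$, $P_{25}=-P_{24}$. These are disjoint open convex polygons whose closures cover $\mathbb{T}^2$. *)

theory Defs
  imports "HOL-Analysis.Analysis"
begin

type_synonym plane = "real \<times> real"

definition phi :: real where
  "phi = (1 + sqrt 5) / 2"

definition kite_A :: real where
  "kite_A = phi powi (-3)"


section \<open>Outer billiards on the quadrilateral\<close>

definition kite_vertices :: "plane set" where
  "kite_vertices = {(0, 1), (-1, 0), (0, -1), (kite_A, 0)}"

definition kite :: "plane set" where
  "kite = convex hull kite_vertices"

definition cross :: "plane \<Rightarrow> plane \<Rightarrow> real" where
  "cross u v = fst u * snd v - snd u * fst v"

text \<open>Tangency at the midpoint means that the line through \<open>x0\<close> and \<open>x1\<close> meets
  the quadrilateral in the midpoint only. A negative cross product means strictly to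
  the right of the ray. In particular no \<open>x1\<close> is related to an \<open>x0\<close> for which the
  line in question contains an edge; there the map is undefined.\<close>

definition outer_billiards_step :: "plane \<Rightarrow> plane \<Rightarrow> bool" where
  "outer_billiards_step x0 x1 \<longleftrightarrow>
     x0 \<notin> kite \<and> midpoint x0 x1 \<in> kite_vertices \<and>
     (\<forall>p\<in>kite. p \<noteq> midpoint x0 x1 \<longrightarrow> cross (x1 - x0) (p - x0) < 0)"

definition outer_billiards :: "plane \<rightharpoonup> plane" where
  "outer_billiards x0 =
     (if \<exists>!x1. outer_billiards_step x0 x1
      then Some (THE x1. outer_billiards_step x0 x1) else None)"

definition Upsilon :: "plane \<rightharpoonup> plane" where
  "Upsilon x = Option.bind (outer_billiards x) outer_billiards"

definition partial_iterate :: "('a \<rightharpoonup> 'a) \<Rightarrow> nat \<Rightarrow> 'a \<rightharpoonup> 'a" where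
  "partial_iterate f n x = ((\<lambda>z. Option.bind z f) ^^ n) (Some x)"

definition returns_at :: "('a \<rightharpoonup> 'a) \<Rightarrow> 'a set \<Rightarrow> 'a \<Rightarrow> nat \<Rightarrow> bool" where
  "returns_at f C x n \<longleftrightarrow> n > 0 \<and> (\<exists>y\<in>C. partial_iterate f n x = Some y)"

definition first_return :: "('a \<rightharpoonup> 'a) \<Rightarrow> 'a set \<Rightarrow> 'a \<rightharpoonup> 'a" where
  "first_return f C x =
     (if x \<in> C \<and> (\<exists>n. returns_at f C x n)
      then partial_iterate f (LEAST n. returns_at f C x n) x else None)"


section \<open>The arithmetic graph\<close>

definition T_map :: "plane \<Rightarrow> real" where
  "T_map = (\<lambda>(x, y). 2 * kite_A * x + 2 * y + (1 - kite_A) / 2)"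

definition lattice :: "plane set" where
  "lattice = \<int> \<times> \<int>"

definition C_pm :: "plane set" where
  "C_pm = (T_map ` lattice \<inter> {0<..}) \<times> {1, -1}"

definition Upsilon_R :: "plane \<rightharpoonup> plane" where
  "Upsilon_R = first_return Upsilon C_pm"

definition H :: "plane set" where
  "H = {z. T_map z > 0}"

definition joined :: "plane \<Rightarrow> plane \<Rightarrow> bool" where
  "joined x1 x2 \<longleftrightarrow>
     x1 \<in> lattice \<inter> H \<and> x2 \<in> lattice \<inter> H \<and> x1 \<noteq> x2 \<and>
     (\<exists>e1\<in>{-1, 1}. \<exists>e2\<in>{-1, 1}. Upsilon_R (T_map x1, e1) = Some (T_map x2, e2))"

definition local_type :: "plane \<Rightarrow> plane set" where
  "local_type x = {x' - x |x'. joined x x'}"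

text \<open>The entries of odd index up to 23; those of index 2, 4, \dots, 22 are their negatives,
  and those of index 24, 25, 26 are empty.\<close>

definition odd_type :: "nat \<Rightarrow> plane set" where
  "odd_type k =
    (if k = 1 then {(1, 1), (0, 1)}
     else if k = 3 then {(-1, 1), (1, 1)}
     else if k = 5 \<or> k = 7 then {(-1, 1), (0, -1)}
     else if k = 9 then {(0, 1), (-1, -1)}
     else if k = 11 \<or> k = 13 then {(1, 1), (-1, 0)}
     else if k = 15 \<or> k = 17 then {(0, -1), (-1, 0)}
     else if k = 19 then {(0, 1), (-1, 0)}
     else if k = 21 \<or> k = 23 then {(0, 1), (0, -1)}
     else {})"

definition type_list :: "nat \<Rightarrow> plane set" where
  "type_list k =
    (if even k \<and> 2 \<le> k \<and> k \<le> 22 then uminus ` odd_type (k - 1) else odd_type k)"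


section \<open>The torus and its partition\<close>

quotient_type torus = "real \<times> real" / "\<lambda>z w. z - w \<in> lattice"
  morphisms rep_torus proj
proof (rule equivpI)
  show "reflp (\<lambda>z w. z - w \<in> lattice)"
    by (rule reflpI) (simp add: lattice_def zero_prod_def)
  show "symp (\<lambda>z w. z - w \<in> lattice)"
  proof (rule sympI)
    fix z w :: plane
    assume "z - w \<in> lattice"
    then show "w - z \<in> lattice"
      unfolding lattice_def mem_Times_iff fst_diff snd_diff
      by (metis Ints_minus minus_diff_eq)
  qed
  show "transp (\<lambda>z w. z - w \<in> lattice)"
  proof (rule transpI)
    fix u v w :: plane
    assume "u - v \<in> lattice" "v - w \<in> lattice"
    then have "(u - v) + (v - w) \<in> lattice"
      unfolding lattice_def mem_Times_iff fst_add snd_add by (blast intro: Ints_add)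
    then show "u - w \<in> lattice" by simp
  qed
qed

instantiation torus :: uminus
begin

lift_definition uminus_torus :: "torus \<Rightarrow> torus" is "\<lambda>z. - z"
proof -
  fix z w :: plane
  assume "z - w \<in> lattice"
  then show "- z - - w \<in> lattice"
    unfolding lattice_def mem_Times_iff fst_diff snd_diff fst_uminus snd_uminus
    by (metis Ints_minus minus_diff_minus)
qed

instance ..

end

definition Psi :: "plane \<Rightarrow> torus" where
  "Psi z = proj (T_map z / (2 * phi), T_map z / 2)"

definition pt :: "int \<Rightarrow> int \<Rightarrow> int \<Rightarrow> int \<Rightarrow> plane" where
  "pt a0 a1 a2 a3 = ((of_int a0 + of_int a1 * phi) / 2, (of_int a2 + of_int a3 * phi) / 2)"

definition polygon_vertices :: "nat \<Rightarrow> plane set" where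
  "polygon_vertices k =
    (if k = 1 then {pt 5 (-3) 0 0, pt 10 (-6) (-6) 4, pt 2 (-1) 0 0}
     else if k = 3 then {pt 0 0 0 0, pt 5 (-3) 0 0, pt 10 (-6) (-6) 4, pt 5 (-3) (-6) 4}
     else if k = 5 then {pt 0 0 0 0, pt 13 (-8) (-6) 4, pt 5 (-3) (-6) 4}
     else if k = 7 then {pt 9 (-5) (-4) 4, pt 4 (-2) 2 0, pt 1 0 2 0, pt 14 (-8) (-4) 4}
     else if k = 9 then {pt 3 (-2) (-4) 2, pt (-5) 3 2 (-2), pt 3 (-2) (-2) 0,
                         pt (-2) 1 (-2) 0, pt 6 (-4) (-8) 4}
     else if k = 11 then {pt 0 0 0 0, pt 5 (-3) (-4) 2, pt (-3) 2 0 0}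
     else if k = 13 then {pt 10 (-6) (-6) 4, pt 5 (-3) (-6) 4, pt (-3) 2 4 (-2)}
     else if k = 15 then {pt 13 (-8) (-6) 4, pt 5 (-3) (-6) 4, pt (-3) 2 4 (-2),
                          pt 5 (-3) (-2) 2}
     else if k = 17 then {pt 12 (-8) (-8) 4, pt 7 (-5) (-8) 4, pt 4 (-3) (-4) 2}
     else if k = 19 then {pt (-4) 2 (-2) 0, pt 1 (-1) (-2) 0, pt 4 (-3) (-6) 2}
     else if k = 21 then {pt 1 (-1) 0 0, pt 6 (-4) (-6) 4, pt (-2) 1 0 0}
     else if k = 23 then {pt 6 (-3) (-2) 2, pt (-2) 2 2 0, pt (-4) 3 4 (-2), pt 4 (-2) 0 0}
     else if k = 24 then {pt 1 (-1) 0 0, pt (-2) 1 0 0, pt 3 (-2) (-4) 2,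
                          pt 1 (-1) (-2) 0, pt (-1) 0 (-2) 0, pt 4 (-3) (-4) 2}
     else if k = 26 then {pt 0 0 0 0, pt 5 (-3) (-4) 2, pt 0 0 (-2) 0, pt (-5) 3 2 (-2)}
     else {})"

definition listed_polygon :: "nat \<Rightarrow> torus set" where
  "listed_polygon k = proj ` interior (convex hull (polygon_vertices k))"

definition polygon :: "nat \<Rightarrow> torus set" where
  "polygon k =
    (if even k \<and> 2 \<le> k \<and> k \<le> 22 \<or> k = 25
     then uminus ` listed_polygon (k - 1) else listed_polygon k)"

end

theory Submission
  imports Defs
begin

text \<open>
Let \<open>D\<close> be the union of the two rays \<open>(0, \<infinity>) \<times> {1, -1}\<close>. An orbit of the
outer billiards map jumps back and forth between opposite sides of the kite, while it slowly winds
around it. Its first return to \<open>D\<close>, called the half trip below, occurs after an odd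
number of steps. Therefore the first return map of the square is the half trip applied twice
(\<open>first_return_two_half_trips\<close>). The neighbours of a vertex \<open>x\<close> of the arithmetic
graph are found by following the two points \<open>(t, 1)\<close> and \<open>(t, -1)\<close> with
\<open>t = T_map x\<close> for two half trips each.

During a half trip the orbit of the square performs a few runs with constant displacement. The
half trip is thus described by four integers, a height and three lengths of runs, and these are
determined by the condition that each run ends when it crosses a certain line
(\<open>half_trip_stages\<close>). The condition amounts to four affine functions having values
between 0 and 4.

Write \<open>t = X + 2 phi i = Y + 2 j\<close> with integers \<open>i\<close> and \<open>j\<close>. The four
conditions do not change when \<open>i\<close> and \<open>j\<close> are absorbed by the four integers
(\<open>admissible_shift\<close>), so they are conditions on the point
\<open>(X / (2 phi), Y / 2)\<close> of the torus. This is \<open>Psi\<close>. On \<open>(X, Y)\<close> the half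
trip acts as an affine map with the same \<open>i\<close> and \<open>j\<close>. Hence the points of the torus
with given integers for the two half trips, from both rays, form a convex polygon, and the
partition of the torus consists of these polygons. To see that a given polygon is contained in the
one with the integers in the table, it suffices to look at its vertices, by convexity
(\<open>admissible_on_tile\<close>). This is a finite computation with numbers \<open>a + b phi\<close>.
The displacement in the arithmetic graph is read off from the integers, which gives the local types
(\<open>local_type_trips\<close>, \<open>polygon_table_polygons\<close>).

The integers are determined by \<open>t\<close>, and they differ for any two of the 26 polygons. So
\<open>Psi x\<close> lies in at most one polygon (\<open>row_unique\<close>). That it lies in one is shown by
cutting the torus along horizontal lines through the vertices. In each slab the polygons are seen in
order from left to right, with common boundary lines, and a congruence modulo 2 or 4 shows that
\<open>Psi x\<close> lies on none of the lines (\<open>half_odd_covered\<close>).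
\<close>

section \<open>The golden ratio\<close>

lemma phi_square: "phi * phi = phi + 1"
proof -
  have "sqrt 5 * sqrt 5 = (5::real)" by simp
  then show ?thesis by (simp add: phi_def field_simps)
qed

lemma phi_bounds: "161803 / 100000 < phi" "phi < 161804 / 100000"
proof -
  have "223606 / 100000 < sqrt (5::real)"
    by (rule real_less_rsqrt) (simp add: power2_eq_square)
  then show "161803 / 100000 < phi" by (simp add: phi_def)
  have "sqrt (5::real) < 223608 / 100000"
    by (rule real_less_lsqrt) (simp_all add: power2_eq_square)
  then show "phi < 161804 / 100000" by (simp add: phi_def)
qed

lemma kite_A_phi: "kite_A = 2 * phi - 3"
proof -
  have "(2 * phi - 3) * (phi * phi * phi) = 1"
    using phi_square by algebra
  moreover have "phi * phi * phi \<noteq> 0" using phi_bounds by simp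
  ultimately show ?thesis
    by (simp add: kite_A_def power_int_minus field_simps power3_eq_cube)
qed

lemma kite_A_bounds: "0 < kite_A" "kite_A < 1 / 4"
  using phi_bounds by (simp_all add: kite_A_phi)

section \<open>Outer billiards around a kite\<close>

abbreviation north :: plane where "north \<equiv> (0, 1)"
abbreviation west :: plane where "west \<equiv> (-1, 0)"
abbreviation south :: plane where "south \<equiv> (0, -1)"
abbreviation east :: plane where "east \<equiv> (kite_A, 0)"

text \<open>The ray from \<open>x\<close> through \<open>v\<close> has the kite on its right. Only the
vertices are tested, so that for a point with known coordinates this becomes two linear
inequalities; convexity transfers it to the whole kite.\<close>

definition sees :: "plane \<Rightarrow> plane \<Rightarrow> bool" where
  "sees v x \<longleftrightarrow> v \<in> kite_vertices \<and> (\<forall>w\<in>kite_vertices. w \<noteq> v \<longrightarrow> cross (v - x) (w - x) < 0)"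

lemma cross_affine:
  assumes "a + b = 1"
  shows "cross u (a *\<^sub>R p + b *\<^sub>R q - x) = a * cross u (p - x) + b * cross u (q - x)"
proof -
  have b: "b = 1 - a" using assms by simp
  show ?thesis unfolding b by (simp add: cross_def algebra_simps)
qed

lemma sees_kite:
  assumes "sees v x" "p \<in> kite" "p \<noteq> v"
  shows "cross (v - x) (p - x) < 0"
proof -
  let ?f = "\<lambda>p. cross (v - x) (p - x)"
  let ?C = "insert v {p. ?f p < 0}"
  have vv: "?f v = 0" by (simp add: cross_def)
  have "convex ?C"
  proof (rule convexI)
    fix p q :: plane and a b :: real
    assume h: "p \<in> ?C" "q \<in> ?C" "0 \<le> a" "0 \<le> b" "a + b = 1"
    have le: "?f p \<le> 0" "?f q \<le> 0" using h vv by auto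
    have f: "?f (a *\<^sub>R p + b *\<^sub>R q) = a * ?f p + b * ?f q" using h(5) by (rule cross_affine)
    consider "a = 0" | "b = 0" | "a > 0" "b > 0" using h by linarith
    then show "a *\<^sub>R p + b *\<^sub>R q \<in> ?C"
    proof cases
      case 3
      show ?thesis
      proof (cases "p = v \<and> q = v")
        case True
        then show ?thesis using h(5) by (simp flip: scaleR_add_left)
      next
        case False
        then have "?f p < 0 \<or> ?f q < 0" using h by auto
        then have "a * ?f p < 0 \<or> b * ?f q < 0" using 3 by (auto simp: mult_pos_neg)
        moreover have "a * ?f p \<le> 0" "b * ?f q \<le> 0" using 3 le by (auto simp: mult_nonneg_nonpos)
        ultimately have "a * ?f p + b * ?f q < 0" by linarith
        then show ?thesis using f by simp
      qed
    qed (use h in auto)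
  qed
  moreover have "kite_vertices \<subseteq> ?C" using assms(1) by (auto simp: sees_def)
  ultimately have "kite \<subseteq> ?C" unfolding kite_def by (rule hull_minimal[rotated])
  then show ?thesis using assms(2,3) by auto
qed

lemma outer_billiards_sees:
  assumes "sees v x"
  shows "outer_billiards x = Some (2 *\<^sub>R v - x)"
proof -
  have v: "v \<in> kite_vertices" using assms by (simp add: sees_def)
  have V: "kite_vertices \<subseteq> kite" by (simp add: kite_def hull_subset)
  have x_v: "x \<noteq> v"
  proof
    assume "x = v"
    have "north \<in> kite_vertices" "south \<in> kite_vertices" "north \<noteq> south"
      by (simp_all add: kite_vertices_def)
    then obtain w where "w \<in> kite_vertices" "w \<noteq> v" by metis
    then have "cross (v - x) (w - x) < 0" using assms by (simp add: sees_def)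
    then show False using \<open>x = v\<close> by (simp add: cross_def)
  qed
  have out: "x \<notin> kite"
  proof
    assume "x \<in> kite"
    then have "cross (v - x) (x - x) < 0" using sees_kite[OF assms _ x_v] by blast
    then show False by (simp add: cross_def)
  qed
  have mid: "midpoint x (2 *\<^sub>R v - x) = v" by (simp add: midpoint_def)
  have dir: "cross (2 *\<^sub>R v - x - x) r = 2 * cross (v - x) r" for r
    by (simp add: cross_def algebra_simps)
  have step: "outer_billiards_step x (2 *\<^sub>R v - x)"
    unfolding outer_billiards_step_def mid dir using out v sees_kite[OF assms] by auto
  have uniq: "y = 2 *\<^sub>R v - x" if y: "outer_billiards_step x y" for y
  proof -
    let ?w = "midpoint x y"
    have yw: "y = 2 *\<^sub>R ?w - x" by (simp add: midpoint_def)
    have w: "?w \<in> kite_vertices" using y by (simp add: outer_billiards_step_def)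
    have "?w = v"
    proof (rule ccontr)
      \<comment> \<open>otherwise each of the two vertices lies to the right of the ray through the other\<close>
      assume ne: "?w \<noteq> v"
      have "cross (y - x) (v - x) < 0" using y v V ne by (auto simp: outer_billiards_step_def)
      moreover have "y - x = 2 *\<^sub>R (?w - x)" by (simp add: midpoint_def algebra_simps scaleR_2)
      moreover have "cross (2 *\<^sub>R (?w - x)) (v - x) = 2 * cross (?w - x) (v - x)"
        by (simp add: cross_def algebra_simps)
      ultimately have "cross (?w - x) (v - x) < 0" by simp
      moreover have "cross (v - x) (?w - x) < 0" using assms w ne by (simp add: sees_def)
      moreover have "cross (v - x) (?w - x) = - cross (?w - x) (v - x)" by (simp add: cross_def)
      ultimately show False by linarith
    qed
    then show ?thesis using yw by simp
  qed
  have "\<exists>!y. outer_billiards_step x y" using step uniq by blast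
  moreover have "(THE y. outer_billiards_step x y) = 2 *\<^sub>R v - x"
    using step uniq by (rule the_equality)
  ultimately show ?thesis by (simp add: outer_billiards_def)
qed

lemma sees_north:
  assumes "y > x + 1" "x < kite_A * (1 - y)"
  shows "sees north (x, y)"
proof -
  have "kite_A * (x + 1) < kite_A * y" using assms kite_A_bounds by simp
  then have "(1 + kite_A) * x < 0" using assms by (simp add: algebra_simps)
  then have "x < 0" using kite_A_bounds by (simp add: mult_less_0_iff)
  then show ?thesis using assms
    by (auto simp: sees_def kite_vertices_def cross_def algebra_simps)
qed

lemma sees_west:
  assumes "y < x + 1" "x + y + 1 < 0"
  shows "sees west (x, y)"
proof -
  have "(1 + kite_A) * y < 0"
    using assms kite_A_bounds by (intro mult_pos_neg) auto
  then show ?thesis using assms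
    by (auto simp: sees_def kite_vertices_def cross_def algebra_simps)
qed

lemma sees_south:
  assumes "x + y + 1 > 0" "x > kite_A * (1 + y)"
  shows "sees south (x, y)"
proof -
  have "0 < kite_A * (x + y + 1)" using assms kite_A_bounds by simp
  then have "0 < (1 + kite_A) * x" using assms by (simp add: algebra_simps)
  then have "0 < x" using kite_A_bounds by (simp add: zero_less_mult_iff)
  then show ?thesis using assms
    by (auto simp: sees_def kite_vertices_def cross_def algebra_simps)
qed

lemma sees_east:
  assumes "x > kite_A * (1 - y)" "x < kite_A * (1 + y)"
  shows "sees east (x, y)"
proof -
  have "0 < kite_A * y" using assms by (simp add: algebra_simps)
  then have "0 < y" using kite_A_bounds by (simp add: zero_less_mult_iff)
  then show ?thesis using assms mult_pos_pos[of kite_A y] kite_A_bounds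
    by (auto simp: sees_def kite_vertices_def cross_def algebra_simps)
qed

section \<open>Returns to the two horizontal rays\<close>

text \<open>The part of these rays over the image of the lattice under \<open>T_map\<close> is \<open>C_pm\<close>.
The rays are preferred as a section because the half trip reflects that image: it leads from
\<open>C_pm\<close> back to the rays, but not into \<open>C_pm\<close>.\<close>

definition axis_rays :: "plane set" where
  "axis_rays = {0<..} \<times> {1, -1}"

lemma axis_rays_iff: "(x, y) \<in> axis_rays \<longleftrightarrow> 0 < x \<and> (y = 1 \<or> y = -1)"
  by (simp add: axis_rays_def)

lemma partial_iterate_add:
  "partial_iterate f m x = Some y \<Longrightarrow> partial_iterate f (m + n) x = partial_iterate f n y"
  by (simp add: partial_iterate_def add.commute[of m n] funpow_add)

lemma partial_iterate_0: "partial_iterate f 0 x = Some x"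
  and partial_iterate_1: "partial_iterate f (Suc 0) x = f x"
  by (simp_all add: partial_iterate_def)

lemma partial_iterate_Upsilon:
  "partial_iterate Upsilon n x = partial_iterate outer_billiards (2 * n) x"
proof -
  let ?f = "\<lambda>z. Option.bind z outer_billiards"
  have "(\<lambda>z. Option.bind z Upsilon) = ?f ^^ 2"
    by (auto simp: Upsilon_def numeral_2_eq_2 fun_eq_iff split: bind_split)
  then show ?thesis by (simp add: partial_iterate_def funpow_mult)
qed

text \<open>A path of the outer billiards map itself, not of its square, which avoids the rays after its start.
The orbit of a point under the square and its antipodal companion are followed at the same time.\<close>

definition clear_path :: "nat \<Rightarrow> plane \<Rightarrow> plane \<Rightarrow> bool" where
  "clear_path m p q \<longleftrightarrow> partial_iterate outer_billiards m p = Some q \<and>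
     (\<forall>i r. 0 < i \<longrightarrow> i \<le> m \<longrightarrow> partial_iterate outer_billiards i p = Some r \<longrightarrow> r \<notin> axis_rays)"

lemma clear_path_0: "clear_path 0 p p"
  by (simp add: clear_path_def partial_iterate_0)

lemma clear_path_1:
  "outer_billiards p = Some q \<Longrightarrow> q \<notin> axis_rays \<Longrightarrow> clear_path 1 p q"
  by (auto simp: clear_path_def partial_iterate_1 le_Suc_eq)

lemma clear_path_trans:
  assumes "clear_path m p q" "clear_path n q r"
  shows "clear_path (m + n) p r"
  unfolding clear_path_def
proof (intro conjI allI impI)
  have pq: "partial_iterate outer_billiards m p = Some q" using assms(1) by (simp add: clear_path_def)
  show "partial_iterate outer_billiards (m + n) p = Some r"
    using partial_iterate_add[OF pq] assms(2) by (simp add: clear_path_def)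
  fix i s
  assume i: "0 < i" "i \<le> m + n" and s: "partial_iterate outer_billiards i p = Some s"
  show "s \<notin> axis_rays"
  proof (cases "i \<le> m")
    case True
    then show ?thesis using assms(1) i s unfolding clear_path_def by blast
  next
    case False
    then have "partial_iterate outer_billiards (i - m) q = Some s"
      using partial_iterate_add[OF pq, of "i - m"] s by simp
    then show ?thesis using assms(2) i False unfolding clear_path_def
      by (metis diff_is_0_eq le_diff_conv add.commute not_gr_zero)
  qed
qed

text \<open>Two successive reflections, in \<open>v\<close> and then in \<open>w\<close>, add up to the
translation by \<open>2 (w - v)\<close>. As long as the orbit stays in the region where these two
vertices are seen, it moves along an arithmetic progression.\<close>

lemma clear_run:
  fixes n :: nat and x y a b :: real
  assumes "\<And>k::nat. k < n \<Longrightarrow>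
      sees v (x + k * a, y + k * b) \<and> sees w (2 *\<^sub>R v - (x + k * a, y + k * b)) \<and>
      2 *\<^sub>R v - (x + k * a, y + k * b) \<notin> axis_rays \<and>
      (x + (real k + 1) * a, y + (real k + 1) * b) \<notin> axis_rays"
    and ab: "(a, b) = 2 *\<^sub>R (w - v)"
  shows "clear_path (2 * n) (x, y) (x + n * a, y + n * b)"
  using assms(1)
proof (induction n)
  case 0
  then show ?case by (simp add: clear_path_0)
next
  case (Suc n)
  let ?p = "(x + n * a, y + n * b)"
  let ?q = "(x + (real n + 1) * a, y + (real n + 1) * b)"
  have h: "sees v ?p" "sees w (2 *\<^sub>R v - ?p)" "2 *\<^sub>R v - ?p \<notin> axis_rays" "?q \<notin> axis_rays"
    using Suc.prems[of n] by auto
  have "2 *\<^sub>R w - (2 *\<^sub>R v - ?p) = ?p + (a, b)"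
    unfolding ab by (simp add: algebra_simps)
  also have "\<dots> = ?q" by (simp add: algebra_simps)
  finally have "clear_path 1 (2 *\<^sub>R v - ?p) ?q"
    using clear_path_1[OF outer_billiards_sees[OF h(2)]] h(4) by simp
  then have "clear_path (1 + 1) ?p ?q"
    using clear_path_1[OF outer_billiards_sees[OF h(1)] h(3)] clear_path_trans by blast
  moreover have "clear_path (2 * n) (x, y) ?p" using Suc by simp
  ultimately have "clear_path (2 * n + (1 + 1)) (x, y) ?q" using clear_path_trans by blast
  then show ?case by (simp add: add.commute)
qed

text \<open>The first return of the outer billiards map to the rays, required to happen after an odd number of
steps. The oddness says that the point arrives there along the antipodal companion of its orbit
under the square, half a turn around the kite.\<close>

definition half_trip :: "plane \<Rightarrow> plane \<Rightarrow> bool" where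
  "half_trip p q \<longleftrightarrow> q \<in> axis_rays \<and>
     (\<exists>m r. clear_path (2 * m) p r \<and> outer_billiards r = Some q)"

text \<open>Each half trip is an odd number of reflections, so only the end of the second one is reached by an
even number of them. This is why the return map of the square is the square of the half trip.\<close>

lemma first_return_two_half_trips:
  assumes "half_trip p q" "half_trip q r" "p \<in> C_pm" "r \<in> C_pm"
  shows "Upsilon_R p = Some r"
proof -
  let ?it = "partial_iterate outer_billiards"
  obtain m p' where m: "clear_path (2 * m) p p'" "outer_billiards p' = Some q"
    using assms(1) by (auto simp: half_trip_def)
  obtain n q' where n: "clear_path (2 * n) q q'" "outer_billiards q' = Some r"
    using assms(2) by (auto simp: half_trip_def)
  have pq: "?it (2 * m + 1) p = Some q"
    using m partial_iterate_add[of outer_billiards "2 * m" p p' 1]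
    by (simp add: clear_path_def partial_iterate_1)
  have qr: "?it (2 * n + 1) q = Some r"
    using n partial_iterate_add[of outer_billiards "2 * n" q q' 1]
    by (simp add: clear_path_def partial_iterate_1)
  have pr: "?it (2 * (m + n + 1)) p = Some r"
    using partial_iterate_add[OF pq, of "2 * n + 1"] qr by (simp add: algebra_simps)
  have sub: "C_pm \<subseteq> axis_rays" by (auto simp: C_pm_def axis_rays_def)
  have no: "\<not> returns_at Upsilon C_pm p i" if "i < m + n + 1" for i
  proof
    assume ret: "returns_at Upsilon C_pm p i"
    then obtain s where s: "0 < i" "s \<in> axis_rays" "?it (2 * i) p = Some s"
      using sub by (auto simp: returns_at_def partial_iterate_Upsilon)
    show False
    proof (cases "i \<le> m")
      case True
      then show False using m(1) s unfolding clear_path_def by (metis mult_le_mono2 nat_0_less_mult_iff zero_less_numeral)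
    next
      case False
      \<comment> \<open>the even iterates of the second half are odd iterates of \<open>q\<close>, so they miss \<open>q\<close> itself\<close>
      define l where "l = 2 * (i - m - 1) + 1"
      have l: "2 * i = 2 * m + 1 + l" "0 < l" "l \<le> 2 * n" using False that by (auto simp: l_def)
      have "?it l q = Some s" using partial_iterate_add[OF pq, of l] s(3) l(1) by simp
      then show False using n(1) l(2,3) s(2) unfolding clear_path_def by blast
    qed
  qed
  have yes: "returns_at Upsilon C_pm p (m + n + 1)"
    using pr assms(4) by (simp add: returns_at_def partial_iterate_Upsilon)
  have "(LEAST i. returns_at Upsilon C_pm p i) = m + n + 1"
    using yes no by (metis Least_equality not_le_imp_less)
  then show ?thesis using yes pr assms(3)
    by (auto simp: Upsilon_R_def first_return_def partial_iterate_Upsilon)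
qed

section \<open>The half trip\<close>

text \<open>The even iterates of a half trip form at most five runs. Seen from a distant point, the two tangent
vertices change only when the direction of the point passes that of an edge of the kite, so the
translation vectors are, in this order, \<open>(0, 4)\<close>, \<open>(-2, 2)\<close>,
\<open>(-2 - 2 kite_A, 0)\<close>, \<open>(-2, -2)\<close> and \<open>(0, -4)\<close>. In each of
the five lemmas below, the inequality that bounds the region ahead is only required at the last step
of the run: at the earlier steps it holds with more room.\<close>

lemma run_from_south_to_north:
  fixes x y :: real and n :: nat
  assumes "0 < x" "-1 \<le> y" and top: "0 < n \<Longrightarrow> y + 4 * (real n - 1) < x - 3"
  shows "clear_path (2 * n) (x, y) (x, y + 4 * n)"
proof -
  have "clear_path (2 * n) (x, y) (x + real n * 0, y + real n * 4)"
  proof (rule clear_run[where v = south and w = north])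
    fix k :: nat assume k: "k < n"
    let ?y = "y + real k * 4"
    have y: "?y \<ge> -1" "?y < x - 3" using assms(2) top k by auto
    have "kite_A * (1 + ?y) \<le> kite_A * x" "kite_A * x < 1 * x"
      using y kite_A_bounds assms(1) by (intro mult_left_mono mult_strict_right_mono; simp)+
    then have "sees south (x, ?y)" by (intro sees_south) (use y assms(1) in linarith)+
    moreover have "0 \<le> kite_A * (3 + ?y)" using y kite_A_bounds by simp
    then have "sees north (- x, - 2 - ?y)"
      using y assms(1) by (intro sees_north) (auto simp: algebra_simps)
    ultimately show "sees south (x + real k * 0, ?y) \<and> sees north (2 *\<^sub>R south - (x + real k * 0, ?y)) \<and>
        2 *\<^sub>R south - (x + real k * 0, ?y) \<notin> axis_rays \<and>
        (x + (real k + 1) * 0, y + (real k + 1) * 4) \<notin> axis_rays"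
      using assms(1) y by (auto simp: axis_rays_iff)
  qed simp
  then show ?thesis by (simp add: mult.commute)
qed

lemma run_from_south_to_west:
  fixes x y :: real and n :: nat
  assumes y: "y = -1 \<or> 1 \<le> y" "x - 3 < y"
    and last: "0 < n \<Longrightarrow> kite_A * (1 + (y + 2 * (real n - 1))) < x - 2 * (real n - 1)"
  shows "clear_path (2 * n) (x, y) (x - 2 * n, y + 2 * n)"
proof -
  have "clear_path (2 * n) (x, y) (x + real n * (-2), y + real n * 2)"
  proof (rule clear_run[where v = south and w = west])
    fix k :: nat assume k: "k < n"
    let ?x = "x + real k * (-2)" and ?y = "y + real k * 2"
    have "0 \<le> kite_A * (real n - 1 - k)" using k kite_A_bounds by simp
    then have x: "?x > kite_A * (1 + ?y)" using last k by (simp add: algebra_simps)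
    have yk: "?y \<ge> -1" "?y > ?x - 3" using y by auto
    have "0 \<le> kite_A * (1 + ?y)" using yk kite_A_bounds by simp
    then have x0: "?x > 0" using x by linarith
    have "sees south (?x, ?y)" using x x0 yk by (intro sees_south) auto
    moreover have "sees west (- ?x, - 2 - ?y)" using x0 yk by (intro sees_west) auto
    moreover have "?x - 2 < 0 \<or> ?y + 2 > 1" using y by (cases "k = 0") auto
    ultimately show "sees south (?x, ?y) \<and> sees west (2 *\<^sub>R south - (?x, ?y)) \<and>
        2 *\<^sub>R south - (?x, ?y) \<notin> axis_rays \<and>
        (x + (real k + 1) * (-2), y + (real k + 1) * 2) \<notin> axis_rays"
      using x0 yk by (auto simp: axis_rays_iff algebra_simps)
  qed simp
  then show ?thesis by (simp add: mult.commute)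
qed

lemma run_from_east_to_west:
  fixes x y :: real and n :: nat
  assumes y: "0 < n \<Longrightarrow> 3 \<le> y" and first: "x < kite_A * (1 + y)"
    and last: "0 < n \<Longrightarrow> kite_A * (1 - y) < x - (2 + 2 * kite_A) * (real n - 1)"
  shows "clear_path (2 * n) (x, y) (x - (2 + 2 * kite_A) * n, y)"
proof -
  have "clear_path (2 * n) (x, y) (x + real n * (-(2 + 2 * kite_A)), y + real n * 0)"
  proof (rule clear_run[where v = east and w = west])
    fix k :: nat assume k: "k < n"
    let ?x = "x + real k * (-(2 + 2 * kite_A))"
    have y3: "y \<ge> 3" using y k by simp
    have "0 \<le> (2 + 2 * kite_A) * (real n - 1 - k)"
      using k kite_A_bounds by (intro mult_nonneg_nonneg) auto
    then have x_low: "?x > kite_A * (1 - y)" using last k by (simp add: algebra_simps)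
    have "0 \<le> real k * (2 + 2 * kite_A)" using kite_A_bounds by simp
    then have x_high: "?x < kite_A * (1 + y)" using first by (simp add: algebra_simps)
    have "kite_A * 3 \<le> kite_A * y" "(1 - kite_A) * 3 \<le> (1 - kite_A) * y"
      using y3 kite_A_bounds by (intro mult_left_mono; simp)+
    then have ay: "kite_A * 3 \<le> kite_A * y" "3 - 3 * kite_A \<le> y - kite_A * y"
      by (simp_all add: algebra_simps)
    have lo: "?x > kite_A - kite_A * y" and hi: "?x < kite_A + kite_A * y"
      using x_low x_high by (simp_all add: algebra_simps)
    have "sees east (?x, y)" using x_low x_high by (rule sees_east)
    moreover have "sees west (2 * kite_A - ?x, - y)"
      by (rule sees_west) (use lo hi ay kite_A_bounds y3 in linarith)+
    ultimately show "sees east (?x, y + real k * 0) \<and> sees west (2 *\<^sub>R east - (?x, y + real k * 0)) \<and>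
        2 *\<^sub>R east - (?x, y + real k * 0) \<notin> axis_rays \<and>
        (x + (real k + 1) * (-(2 + 2 * kite_A)), y + (real k + 1) * 0) \<notin> axis_rays"
      using y3 by (auto simp: axis_rays_iff)
  qed simp
  then show ?thesis by (simp add: algebra_simps)
qed

lemma run_from_north_to_west:
  fixes x y :: real and n :: nat
  assumes first: "x < kite_A * (1 - y)" and last: "0 < n \<Longrightarrow> 3 < x + y - 4 * (real n - 1)"
  shows "clear_path (2 * n) (x, y) (x - 2 * n, y - 2 * n)"
proof -
  have "clear_path (2 * n) (x, y) (x + real n * (-2), y + real n * (-2))"
  proof (rule clear_run[where v = north and w = west])
    fix k :: nat assume k: "k < n"
    let ?x = "x + real k * (-2)" and ?y = "y + real k * (-2)"
    have xy: "?x + ?y > 3" using last k by (simp add: algebra_simps)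
    have "0 \<le> kite_A * k" using kite_A_bounds by simp
    then have x: "?x < kite_A * (1 - ?y)" using first by (simp add: algebra_simps)
    have "kite_A * (3 - ?x) < kite_A * ?y" using xy kite_A_bounds by simp
    then have "(1 - kite_A) * ?x < 0" using x kite_A_bounds by (simp add: algebra_simps)
    then have x0: "?x < 0" using kite_A_bounds by (simp add: mult_less_0_iff)
    have "sees north (?x, ?y)" using x x0 xy by (intro sees_north) auto
    moreover have "sees west (- ?x, 2 - ?y)" using x0 xy by (intro sees_west) auto
    moreover have "2 - ?y < -1" using x0 xy by linarith
    ultimately show "sees north (?x, ?y) \<and> sees west (2 *\<^sub>R north - (?x, ?y)) \<and>
        2 *\<^sub>R north - (?x, ?y) \<notin> axis_rays \<and>
        (x + (real k + 1) * (-2), y + (real k + 1) * (-2)) \<notin> axis_rays"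
      using x0 by (auto simp: axis_rays_iff)
  qed simp
  then show ?thesis by (simp add: mult.commute)
qed

lemma run_from_north_to_south:
  fixes x y :: real and n :: nat
  assumes first: "x < 0" "x + y < 3" "x < kite_A * (1 - y)"
    and last: "0 < n \<Longrightarrow> 5 \<le> y - 4 * (real n - 1)"
  shows "clear_path (2 * n) (x, y) (x, y - 4 * n)"
proof -
  have "clear_path (2 * n) (x, y) (x + real n * 0, y + real n * (-4))"
  proof (rule clear_run[where v = north and w = south])
    fix k :: nat assume k: "k < n"
    let ?y = "y + real k * (-4)"
    have y: "?y \<ge> 5" "?y \<le> y" using last k by auto
    have "kite_A * ?y \<le> kite_A * y" "0 \<le> kite_A * (?y - 3)"
      using y kite_A_bounds by simp_all
    then have "x < kite_A * (1 - ?y)" "kite_A * (3 - ?y) \<le> 0"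
      using first(3) by (simp_all add: algebra_simps)
    then have "sees north (x, ?y)" "sees south (- x, 2 - ?y)"
      using y first by (auto intro!: sees_north sees_south simp: algebra_simps)
    then show "sees north (x + real k * 0, ?y) \<and> sees south (2 *\<^sub>R north - (x + real k * 0, ?y)) \<and>
        2 *\<^sub>R north - (x + real k * 0, ?y) \<notin> axis_rays \<and>
        (x + (real k + 1) * 0, y + (real k + 1) * (-4)) \<notin> axis_rays"
      using y first(1) by (auto simp: axis_rays_iff)
  qed simp
  then show ?thesis by (simp add: mult.commute)
qed

text \<open>The integers \<open>y1\<close>, \<open>n2\<close>, \<open>n3\<close>, \<open>n4\<close> are the height
reached by the first run and the lengths of the next three. In each pair of hypotheses, one
inequality says that the line which ends the run has been crossed, the other that it had not been
crossed one step earlier. The length of the last run, down to height 1 or 3, does not influence the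
result. For \<open>t < 2 kite_A\<close> and \<open>e = 1\<close> the orbit has a different shape, but the same
formula gives the correct result, with \<open>n3 = 1\<close> and \<open>n4 = -1\<close>.\<close>

lemma half_trip_stages:
  fixes t :: real and e y1 n2 n3 n4 :: int
  assumes t: "0 < t" and e: "e = 1 \<or> e = -1" and y1e: "4 dvd y1 - e"
    and h1: "t - 3 < y1" "y1 < t + 1"
    and h2: "kite_A * (y1 + 2 * n2 - 1) - 2 < t - 2 * n2"
            "t - 2 * n2 < kite_A * (y1 + 2 * n2 + 1)"
    and h3: "kite_A * (1 - y1 - 2 * n2) - (2 + 2 * kite_A) < t - 2 * n2 - (2 + 2 * kite_A) * n3"
            "t - 2 * n2 - (2 + 2 * kite_A) * n3 < kite_A * (1 - y1 - 2 * n2)"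
    and h4: "-1 < t + y1 - (2 + 2 * kite_A) * n3 - 4 * n4"
            "t + y1 - (2 + 2 * kite_A) * n3 - 4 * n4 < 3"
  shows "half_trip (t, real_of_int e) (2 * n2 + (2 + 2 * kite_A) * n3 + 2 * n4 - t,
     real_of_int (if even (n2 + n4) then e else - e))"
proof -
  let ?A = kite_A
  note A = kite_A_bounds
  obtain n1 where n1: "y1 = e + 4 * n1" using y1e by (metis add.commute diff_add_cancel dvdE)
  have "real_of_int y1 > -3" using h1 t by linarith
  then have "y1 > -3" by simp
  then have n1_0: "n1 \<ge> 0" using n1 e by auto
  then have y1_ge: "y1 \<ge> -1" using n1 e by auto
  have y1_odd: "odd y1" using n1 e by auto
  have n2_0: "n2 \<ge> 0"
  proof (rule ccontr)
    assume "\<not> n2 \<ge> 0"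
    then have n: "real_of_int n2 \<le> -1" by simp
    then have "?A * n2 \<le> ?A * (-1)" using A by (intro mult_left_mono) auto
    moreover have "?A * y1 < ?A * (t + 1)" using h1 A by simp
    moreover have "?A * t < t" using A t by simp
    ultimately show False using h2(2) n A by (simp add: algebra_simps)
  qed
  have y2_pos: "y1 + 2 * n2 \<ge> 1"
  proof (rule ccontr)
    assume "\<not> ?thesis"
    then have "y1 = -1" "n2 = 0" using y1_ge n2_0 y1_odd by presburger+
    then show False using h2(2) t by simp
  qed
  have odd2: "odd (y1 + 2 * n2)" using y1_odd by simp
  show ?thesis
  proof (cases "y1 = 1 \<and> n2 = 0")
    \<comment> \<open>close to the vertex \<open>east\<close> a single reflection in it is the whole half trip\<close>
    case True
    then have e1: "e = 1" using n1 e by presburger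
    have t2: "t < 2 * ?A" using h2(2) True by simp
    have "n3 = 1"
    proof -
      have "(2 + 2 * ?A) * n3 > 0" using h3(2) True t by simp
      then have "n3 > 0" using A by (simp add: zero_less_mult_iff)
      moreover have "(2 + 2 * ?A) * (n3 - 1) < (2 + 2 * ?A) * 1"
        using h3(1) True t2 A by (simp add: algebra_simps)
      then have "real_of_int n3 - 1 < 1" using A by (subst (asm) mult_less_cancel_left_pos) auto
      ultimately show ?thesis by linarith
    qed
    moreover have "n4 = -1"
    proof -
      have "-1 < t - 2 * ?A - 1 - 4 * n4" "t - 2 * ?A - 1 - 4 * n4 < 3"
        using h4 True \<open>n3 = 1\<close> by auto
      then have "4 * n4 < 0" "4 * n4 > -8" using t t2 A by linarith+
      then show ?thesis by linarith
    qed
    moreover have "sees east (t, 1)" using t t2 by (intro sees_east) auto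
    then have "outer_billiards (t, 1) = Some (2 * ?A - t, -1)"
      by (simp add: outer_billiards_sees)
    then have "half_trip (t, 1) (2 * ?A - t, -1)"
      unfolding half_trip_def using t2
      by (intro conjI exI[of _ "0::nat"] exI[of _ "(t, 1)"]) (simp_all add: axis_rays_iff clear_path_0)
    ultimately show ?thesis using True e1 by simp
  next
    case False
    let ?y2 = "y1 + 2 * n2" and ?x2 = "t - 2 * n2"
    let ?x3 = "?x2 - (2 + 2 * ?A) * n3"
    let ?x4 = "?x3 - 2 * n4" and ?y4 = "?y2 - 2 * n4"
    \<comment> \<open>if the top run is at height 1 it is empty\<close>
    have y2_cases: "?y2 \<ge> 3 \<or> ?y2 = 1 \<and> n3 = 0"
    proof (cases "?y2 \<ge> 3")
      case False
      then have y2: "?y2 = 1" using y2_pos odd2 by presburger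
      then have "y1 = -1" "n2 = 1" using \<open>\<not> (y1 = 1 \<and> n2 = 0)\<close> y1_ge n2_0 y1_odd by presburger+
      then have "t < 2" "-(2 + 2 * ?A) < t - 2 - (2 + 2 * ?A) * n3" "t - 2 - (2 + 2 * ?A) * n3 < 0"
        using h1 h3 by auto
      then have "(2 + 2 * ?A) * n3 < (2 + 2 * ?A) * 1" "(2 + 2 * ?A) * (-1) < (2 + 2 * ?A) * n3"
        using t A by (auto simp: algebra_simps)
      then have "real_of_int n3 < 1" "-1 < real_of_int n3"
        using A by (auto simp only: mult_less_cancel_left_pos)
      then show ?thesis using y2 by linarith
    qed auto
    have x2_low: "?x2 > ?A * (?y2 - 1) - 2" using h2(1) by simp
    have n3_0: "n3 \<ge> 0"
    proof (rule ccontr)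
      assume "\<not> n3 \<ge> 0"
      then have "real_of_int n3 \<le> -1" by simp
      then have "(2 + 2 * ?A) * n3 \<le> (2 + 2 * ?A) * (-1)" using A by (intro mult_left_mono) auto
      moreover have "?A * 1 \<le> ?A * ?y2" using y2_pos A by (intro mult_left_mono) auto
      ultimately show False using h3(2) x2_low A by (simp add: algebra_simps)
    qed
    have n4_0: "n4 \<ge> 0"
    proof -
      have "?x3 + ?y2 > -1"
      proof (cases "n3 = 0")
        case True
        have "?A * 1 \<le> ?A * ?y2" "real_of_int ?y2 \<ge> 1" using y2_pos A by (auto intro: mult_left_mono)
        then show ?thesis using True x2_low by (simp add: algebra_simps)
      next
        case False
        then have y3: "real_of_int ?y2 \<ge> 3" using y2_cases by linarith
        then have "(1 - ?A) * 3 \<le> (1 - ?A) * ?y2" using A by (intro mult_left_mono) auto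
        then show ?thesis using h3(1) A by (simp add: algebra_simps)
      qed
      then have "4 * n4 > -4" using h4(2) by (simp add: algebra_simps)
      then show ?thesis by linarith
    qed
    have "0 \<le> real_of_int n4" "0 \<le> ?A * n4" using n4_0 A by simp_all
    then have x4: "?x4 < ?A * (1 - ?y4)" using h3(2) by (simp add: algebra_simps)
    have y4_pos: "?y4 \<ge> 1"
    proof (rule ccontr)
      assume "\<not> ?thesis"
      then have y4: "?y4 \<le> -1" using odd2 by presburger
      define d where "d = -1 - ?y4"
      have d: "0 \<le> d" "real_of_int ?y4 = -1 - d" using y4 by (simp_all add: d_def)
      have "?x4 > d" using h4(1) d(2) by (simp add: algebra_simps)
      moreover have "n4 \<ge> 1" using y4 y2_pos by linarith
      then have n: "real_of_int n4 \<ge> 1" by simp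
      moreover have "1 - ?y2 = d + 2 * (1 - n4)" by (simp add: d_def)
      then have "1 - real_of_int y1 - 2 * real_of_int n2 = d + 2 * (1 - n4)" by linarith
      then have "?A * (1 - y1 - 2 * n2) = ?A * (d + 2 * (1 - n4))" by simp
      then have "?A * (1 - y1 - 2 * n2) = ?A * d + 2 * (?A * (1 - n4))"
        by (simp add: algebra_simps)
      moreover have "?A * d \<le> (1::real) * d" using d(1) A by (intro mult_right_mono) auto
      moreover have "?A * (1 - n4) \<le> 0" using n A by (simp add: mult_nonneg_nonpos)
      ultimately show False using h3(2) by linarith
    qed
    have x4_neg: "?x4 < 0"
    proof -
      have "?A * (1 - ?y4) \<le> 0" using y4_pos A by (intro mult_nonneg_nonpos) auto
      then show ?thesis using x4 by linarith
    qed
    \<comment> \<open>the last run stops at the height from which the reflection in \<open>north\<close> leads to height 1 or -1\<close>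
    define n5 where "n5 = (?y4 - 1) div 4"
    let ?y5 = "?y4 - 4 * n5"
    have odd4: "odd ?y4" using odd2 by simp
    have n5: "n5 \<ge> 0" "?y5 = 1 \<or> ?y5 = 3" using y4_pos odd4 unfolding n5_def by presburger+
    have r_nat: "real (nat n) = n" if "n \<ge> 0" for n :: int using that by simp
    note r = r_nat[OF n1_0] r_nat[OF n2_0] r_nat[OF n3_0] r_nat[OF n4_0] r_nat[OF n5(1)]
    have re: "real_of_int y1 = e + 4 * n1" using n1 by simp
    have r5: "real_of_int y1 + 2 * n2 - 2 * n4 - 4 * n5 \<ge> 1" using n5(2) by linarith
    have run1: "clear_path (2 * nat n1) (t, real_of_int e) (t, real_of_int y1)"
      using run_from_south_to_north[of t "real_of_int e" "nat n1"] t e h1(2) re n1_0 by (auto simp: r)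
    have "real_of_int y1 = -1 \<or> 1 \<le> real_of_int y1" using y1_ge y1_odd
      by (cases "y1 = -1") (auto, presburger)
    then have run2: "clear_path (2 * nat n2) (t, real_of_int y1) (?x2, real_of_int ?y2)"
      using run_from_south_to_west[of "real_of_int y1" t "nat n2"] h1(1) h2(1) n2_0
      by (auto simp: r algebra_simps)
    have "real_of_int ?y2 \<ge> 3" if "0 < nat n3" using y2_cases that by linarith
    then have run3: "clear_path (2 * nat n3) (?x2, real_of_int ?y2) (?x3, real_of_int ?y2)"
      using run_from_east_to_west[of "nat n3" "real_of_int ?y2" ?x2] h2(2) h3(1) n3_0
      by (auto simp: r algebra_simps)
    have run4: "clear_path (2 * nat n4) (?x3, real_of_int ?y2) (?x4, real_of_int ?y4)"
      using run_from_north_to_west[of ?x3 "real_of_int ?y2" "nat n4"] h3(2) h4(1) n4_0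
      by (auto simp: r algebra_simps)
    have run5: "clear_path (2 * nat n5) (?x4, real_of_int ?y4) (?x4, real_of_int ?y5)"
      using run_from_north_to_south[of ?x4 "real_of_int ?y4" "nat n5"] x4_neg x4 h4(2) r5 n5(1)
      by (auto simp: r algebra_simps)
    have "?A * n5 \<ge> 0" using n5(1) A by simp
    then have "?x4 < ?A * (1 - ?y5)" using x4 by (simp add: algebra_simps)
    moreover have "real_of_int ?y5 > ?x4 + 1" using x4_neg r5 by simp
    ultimately have "sees north (?x4, real_of_int ?y5)" by (intro sees_north) auto
    then have last: "outer_billiards (?x4, real_of_int ?y5) = Some (- ?x4, 2 - real_of_int ?y5)"
      by (simp add: outer_billiards_sees)
    have "2 - ?y5 = (if even (n2 + n4) then e else - e)"
      using n5(2) n1 e by presburger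
    then have end_y: "2 - real_of_int ?y5 = real_of_int (if even (n2 + n4) then e else - e)"
      by linarith
    have "clear_path (2 * (nat n1 + nat n2 + nat n3 + nat n4 + nat n5)) (t, real_of_int e)
        (?x4, real_of_int ?y5)"
      using clear_path_trans[OF clear_path_trans[OF clear_path_trans[OF
        clear_path_trans[OF run1 run2] run3] run4] run5]
      by (simp add: distrib_left)
    moreover have "(- ?x4, 2 - real_of_int ?y5) \<in> axis_rays"
      using x4_neg n5(2) by (auto simp: axis_rays_iff)
    ultimately have "half_trip (t, real_of_int e) (- ?x4, 2 - real_of_int ?y5)"
      using last unfolding half_trip_def by blast
    then show ?thesis unfolding end_y by (simp add: algebra_simps)
  qed
qed

section \<open>Computing with golden integers\<close>

text \<open>All numbers that occur in the combinatorial part lie in the ring of integers of the field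
generated by \<open>phi\<close>. Pairs of integers make their signs computable.\<close>

datatype gold = Gold int int

instantiation gold :: "{plus, minus, uminus, times}"
begin

fun plus_gold where "Gold a b + Gold c d = Gold (a + c) (b + d)"
fun minus_gold where "Gold a b - Gold c d = Gold (a - c) (b - d)"
fun uminus_gold where "- Gold a b = Gold (- a) (- b)"
fun times_gold where "Gold a b * Gold c d = Gold (a * c + b * d) (a * d + b * c + b * d)"

instance ..

end

fun val :: "gold \<Rightarrow> real" where
  "val (Gold a b) = a + b * phi"

lemma val_simps [simp]:
  "val (x + y) = val x + val y" "val (x - y) = val x - val y"
  "val (- x) = - val x" "val (x * y) = val x * val y"
proof -
  obtain a b c d where xy: "x = Gold a b" "y = Gold c d" by (metis gold.exhaust)
  show "val (x + y) = val x + val y" "val (x - y) = val x - val y" "val (- x) = - val x"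
    by (simp_all add: xy algebra_simps)
  have "val x * val y = a * c + (a * d + b * c) * phi + b * d * (phi * phi)"
    by (simp add: xy algebra_simps)
  then show "val (x * y) = val x * val y" by (simp add: xy phi_square algebra_simps)
qed

text \<open>These tests are sufficient, not necessary, for the sign: they replace \<open>phi\<close> by
rational bounds. The coefficients below are small enough for them to succeed.\<close>

fun gold_nonneg :: "gold \<Rightarrow> bool" where
  "gold_nonneg (Gold a b) \<longleftrightarrow> 0 \<le> 100000 * a + (if 0 \<le> b then 161803 else 161804) * b"

fun gold_pos :: "gold \<Rightarrow> bool" where
  "gold_pos (Gold a b) \<longleftrightarrow> 0 < 100000 * a + (if 0 \<le> b then 161803 else 161804) * b"

lemma gold_lower_bound:
  fixes a b :: int
  shows "100000 * a + (if 0 \<le> b then 161803 else 161804) * b \<le> 100000 * val (Gold a b)"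
proof (cases "0 \<le> b")
  case True
  then have "real_of_int b * 161803 \<le> b * (100000 * phi)"
    using phi_bounds by (intro mult_left_mono) auto
  then show ?thesis using True by (simp add: algebra_simps)
next
  case False
  then have "real_of_int b * 161804 \<le> b * (100000 * phi)"
    using phi_bounds by (intro mult_left_mono_neg) auto
  then show ?thesis using False by (simp add: algebra_simps)
qed

lemma gold_nonneg: "gold_nonneg x \<Longrightarrow> 0 \<le> val x"
proof (cases x)
  case (Gold a b)
  assume "gold_nonneg x"
  then have "0 \<le> 100000 * a + (if 0 \<le> b then 161803 else 161804) * b" by (simp add: Gold)
  then have "0 \<le> real_of_int (100000 * a + (if 0 \<le> b then 161803 else 161804) * b)"
    by (simp only: of_int_0_le_iff)
  then show ?thesis using gold_lower_bound[of a b] unfolding Gold by linarith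
qed

lemma gold_pos: "gold_pos x \<Longrightarrow> 0 < val x"
proof (cases x)
  case (Gold a b)
  assume "gold_pos x"
  then have "0 < 100000 * a + (if 0 \<le> b then 161803 else 161804) * b" by (simp add: Gold)
  then have "0 < real_of_int (100000 * a + (if 0 \<le> b then 161803 else 161804) * b)"
    by (simp only: of_int_0_less_iff)
  then show ?thesis using gold_lower_bound[of a b] unfolding Gold by linarith
qed

section \<open>Itineraries\<close>

type_synonym itinerary = "int \<times> int \<times> int \<times> int"

text \<open>For \<open>t = X = Y\<close> and the integers \<open>(y1, n2, n3, n4)\<close> of a half trip, the four
affine forms measure by how much each of the first four runs overshoots the line that ends it,
scaled so that one more step of any run adds 4. Requiring all of them to lie strictly between 0
and 4 therefore restates the hypotheses of \<open>half_trip_stages\<close>.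

Two coordinates are used because the conditions only depend on \<open>t\<close> modulo
\<open>2 phi\<close> and modulo 2: write \<open>t = X + 2 phi i = Y + 2 j\<close> and move the
integers \<open>i\<close> and \<open>j\<close> into the itinerary. The point
\<open>(X / (2 phi), Y / 2)\<close> of the torus is then \<open>Psi\<close>.\<close>

fun gap_forms :: "itinerary \<Rightarrow> (gold \<times> gold \<times> gold) list" where
  "gap_forms (c1, c2, c3, c4) =
    [(Gold 0 0, Gold (-1) 0, Gold (c1 + 3) 0),
     (Gold 2 (-2), Gold (-2) 1, Gold (4 * c2 + 2 * (c1 + 1)) (- (c1 + 1))),
     (Gold (-2) 0, Gold 2 (-1), Gold (4 * c3 - 4 * c2 - 2 * (c1 - 1)) (4 * c2 + (c1 - 1))),
     (Gold (-2) 0, Gold 1 0, Gold (4 * c4 - 4 * c3 + 3 - c1) (4 * c3))]"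

definition form_value :: "gold \<times> gold \<times> gold \<Rightarrow> real \<Rightarrow> real \<Rightarrow> real" where
  "form_value = (\<lambda>(a, b, g) X Y. val a * X + val b * Y + val g)"

definition admissible :: "itinerary \<Rightarrow> real \<Rightarrow> real \<Rightarrow> bool" where
  "admissible c X Y \<longleftrightarrow> (\<forall>F\<in>set (gap_forms c). 0 < form_value F X Y \<and> form_value F X Y < 4)"

text \<open>A half trip with itinerary \<open>c\<close> takes \<open>t\<close> to \<open>jump c - t\<close>. It
reflects the line and therefore acts on \<open>(X, Y)\<close> with the same \<open>i\<close> and
\<open>j\<close> by \<open>(jump c - X, Y + jump c - 2 X)\<close>.\<close>

fun jump :: "itinerary \<Rightarrow> gold" where
  "jump (c1, c2, c3, c4) = Gold (2 * (c2 + c4) - 4 * c3) (4 * c3)"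

text \<open>The sign of the ray at the end of a half trip that begins on the ray of sign \<open>e\<close>.\<close>

fun turns :: "itinerary \<Rightarrow> int \<Rightarrow> int" where
  "turns (c1, c2, c3, c4) e = (if even (c2 + c4) then e else - e)"

fun shift :: "int \<Rightarrow> int \<Rightarrow> itinerary \<Rightarrow> itinerary" where
  "shift i j (c1, c2, c3, c4) = (c1 + 2 * j, c2 + i, c3 + i, c4 + i)"

lemma admissible_simps:
  "admissible (c1, c2, c3, c4) X Y \<longleftrightarrow>
     (0 < c1 + 3 - Y \<and> c1 + 3 - Y < 4) \<and>
     (0 < 4 * c2 + (2 - phi) * (c1 + 1 - Y) - 2 * (phi - 1) * X \<and>
      4 * c2 + (2 - phi) * (c1 + 1 - Y) - 2 * (phi - 1) * X < 4) \<and>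
     (0 < 4 * c3 + 4 * (phi - 1) * c2 - (2 - phi) * (c1 - 1 - Y) - 2 * X \<and>
      4 * c3 + 4 * (phi - 1) * c2 - (2 - phi) * (c1 - 1 - Y) - 2 * X < 4) \<and>
     (0 < 4 * c4 + 4 * (phi - 1) * c3 + 3 - c1 + Y - 2 * X \<and>
      4 * c4 + 4 * (phi - 1) * c3 + 3 - c1 + Y - 2 * X < 4)"
  by (simp add: admissible_def form_value_def algebra_simps)

text \<open>This invariance is the reason why the local type of a lattice point depends on \<open>Psi\<close>
only. It rests on \<open>phi * phi = phi + 1\<close>: in every form the multiples of
\<open>i\<close> cancel.\<close>

lemma admissible_shift:
  assumes "X' = X + 2 * phi * i" "Y' = Y + 2 * j"
  shows "admissible (shift i j c) X' Y' \<longleftrightarrow> admissible c X Y"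
proof -
  obtain c1 c2 c3 c4 where c: "c = (c1, c2, c3, c4)" by (metis prod.exhaust)
  have p: "phi * (phi * z) = phi * z + z" for z
    using phi_square by (metis distrib_right mult.assoc mult_1)
  show ?thesis
    unfolding c shift.simps admissible_simps assms by (simp add: algebra_simps p)
qed

lemma val_jump_shift: "val (jump (shift i j c)) = val (jump c) + 4 * phi * i"
  by (cases c) (simp add: algebra_simps)

lemma half_trip_admissible:
  assumes "0 < t" "e = 1 \<or> e = -1" "admissible c t t" "4 dvd fst c - e"
  shows "half_trip (t, real_of_int e) (val (jump c) - t, real_of_int (turns c e))"
proof -
  obtain c1 c2 c3 c4 where c: "c = (c1, c2, c3, c4)" by (metis prod.exhaust)
  define g2 where "g2 = kite_A * (c1 + 2 * c2 + 1) - (t - 2 * c2)"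
  define g3 where "g3 = kite_A * (1 - c1 - 2 * c2) - (t - 2 * c2 - (2 + 2 * kite_A) * c3)"
  have p: "phi * (phi * z) = phi * z + z" for z
    using phi_square by (metis distrib_right mult.assoc mult_1)
  have "phi * g2 = 4 * c2 + (2 - phi) * (c1 + 1 - t) - 2 * (phi - 1) * t"
    "phi * g3 = 4 * c3 + 4 * (phi - 1) * c2 - (2 - phi) * (c1 - 1 - t) - 2 * t"
    "phi * (2 + 2 * kite_A) = 4"
    unfolding g2_def g3_def kite_A_phi by (simp_all add: algebra_simps p phi_square)
  then have "0 < phi * g2" "phi * g2 < phi * (2 + 2 * kite_A)"
    "0 < phi * g3" "phi * g3 < phi * (2 + 2 * kite_A)"
    using assms(3) unfolding c admissible_simps by auto
  then have g: "0 < g2" "g2 < 2 + 2 * kite_A" "0 < g3" "g3 < 2 + 2 * kite_A"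
    using phi_bounds by (simp_all add: zero_less_mult_iff mult_less_cancel_left_pos)
  have "(2 + 2 * kite_A) * c3 = 4 * (phi - 1) * c3" by (simp add: kite_A_phi algebra_simps)
  then have trip: "half_trip (t, real_of_int e) (2 * c2 + (2 + 2 * kite_A) * c3 + 2 * c4 - t,
      real_of_int (if even (c2 + c4) then e else - e))"
    using assms g unfolding c admissible_simps g2_def g3_def
    by (intro half_trip_stages) (auto simp: algebra_simps)
  have "2 * c2 + (2 + 2 * kite_A) * c3 + 2 * c4 = val (jump c)"
    "(if even (c2 + c4) then e else - e) = turns c e"
    by (simp_all add: c kite_A_phi algebra_simps)
  then show ?thesis using trip by (simp only:)
qed

text \<open>Each gap contains its own integer with the factor 4 and otherwise only the integers before it. If
those agree, two values in the open interval from 0 to 4 that differ by a multiple of 4 are equal.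
The first gap contains its integer with the factor 1, but the height of the first run grows in
steps of 4.\<close>

lemma admissible_unique:
  assumes "admissible c X Y" "admissible c' X Y" "4 dvd fst c - fst c'"
  shows "c = c'"
proof -
  obtain c1 c2 c3 c4 where c: "c = (c1, c2, c3, c4)" by (metis prod.exhaust)
  obtain d1 d2 d3 d4 where d: "c' = (d1, d2, d3, d4)" by (metis prod.exhaust)
  note a = assms(1)[unfolded c admissible_simps] assms(2)[unfolded d admissible_simps]
  have "real_of_int c1 - d1 < 4" "real_of_int c1 - d1 > -4" using a by linarith+
  then have "c1 - d1 < 4" "c1 - d1 > -4" by linarith+
  then have 1: "c1 = d1" using assms(3) c d by (auto elim!: dvdE)
  have "4 * real_of_int c2 - 4 * d2 < 4" "4 * real_of_int c2 - 4 * d2 > -4"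
    using a unfolding 1 by linarith+
  then have 2: "c2 = d2" by linarith
  have "4 * real_of_int c3 - 4 * d3 < 4" "4 * real_of_int c3 - 4 * d3 > -4"
    using a unfolding 1 2 by linarith+
  then have 3: "c3 = d3" by linarith
  have "4 * real_of_int c4 - 4 * d4 < 4" "4 * real_of_int c4 - 4 * d4 > -4"
    using a unfolding 1 2 3 by linarith+
  then have 4: "c4 = d4" by linarith
  show ?thesis by (simp add: c d 1 2 3 4)
qed

section \<open>The polygons and their itineraries\<close>

type_synonym polygon_row =
  "nat \<times> (gold \<times> gold) list \<times> (itinerary \<times> itinerary) \<times> (itinerary \<times> itinerary)"

text \<open>Each row gives the index of a listed polygon, its vertices in counterclockwise order as arguments
of \<open>pt\<close>, and two pairs of itineraries. A pair describes two successive half trips, the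
first pair for a height congruent to 1 and the second for a height congruent to -1 modulo 4. The key
fact is that these itineraries are constant on each polygon, so that the partition of the torus is
the partition by itineraries.\<close>

definition listed_table ::
    "(nat \<times> (int \<times> int \<times> int \<times> int) list \<times> (itinerary \<times> itinerary) \<times> (itinerary \<times> itinerary)) list" where
  "listed_table = [
    (1, [(5, -3, 0, 0), (2, -1, 0, 0), (10, -6, -6, 4)],
      ((1, 0, 1, 0), (1, 1, 1, 0)), ((-1, 1, 0, 0), (1, 1, 1, 0))),
    (3, [(0, 0, 0, 0), (5, -3, 0, 0), (10, -6, -6, 4), (5, -3, -6, 4)],
      ((1, 0, 1, -1), (-1, 1, 0, 0)), ((-1, 1, 0, 0), (1, 1, 1, 0))),
    (5, [(0, 0, 0, 0), (5, -3, -6, 4), (13, -8, -6, 4)],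
      ((1, 0, 1, -1), (-1, 1, 0, 0)), ((-1, 1, 0, -1), (-1, 0, 0, -1))),
    (7, [(9, -5, -4, 4), (4, -2, 2, 0), (1, 0, 2, 0), (14, -8, -4, 4)],
      ((1, 1, 0, 0), (-1, 1, 0, -1)), ((3, 1, 1, 0), (1, 2, 0, 1))),
    (9, [(3, -2, -4, 2), (6, -4, -8, 4), (-2, 1, -2, 0), (3, -2, -2, 0), (-5, 3, 2, -2)],
      ((-3, 0, 0, -1), (-5, 0, -1, -1)), ((-1, 0, 0, 0), (-1, 1, 0, 0))),
    (11, [(0, 0, 0, 0), (5, -3, -4, 2), (-3, 2, 0, 0)],
      ((-3, 1, 0, -1), (-3, 1, -1, 0)), ((-1, 1, 0, 0), (1, 1, 1, 0))),
    (13, [(10, -6, -6, 4), (-3, 2, 4, -2), (5, -3, -6, 4)],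
      ((1, 0, 1, -1), (-1, 1, 0, -1)), ((-1, 1, 0, 0), (1, 1, 1, 0))),
    (15, [(13, -8, -6, 4), (5, -3, -6, 4), (-3, 2, 4, -2), (5, -3, -2, 2)],
      ((1, 0, 1, -1), (-1, 1, 0, -1)), ((-1, 1, 0, -1), (-1, 0, 0, -1))),
    (17, [(12, -8, -8, 4), (4, -3, -4, 2), (7, -5, -8, 4)],
      ((-3, 0, -1, -1), (-5, 0, -1, -2)), ((-1, 0, 0, -1), (-3, 1, -1, -1))),
    (19, [(-4, 2, -2, 0), (4, -3, -6, 2), (1, -1, -2, 0)],
      ((-3, 0, 0, -1), (-1, 0, 0, 0)), ((-5, 0, 0, -2), (-5, 0, -1, -1))),
    (21, [(1, -1, 0, 0), (-2, 1, 0, 0), (6, -4, -6, 4)],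
      ((1, 0, 0, 0), (1, 1, 0, 0)), ((-1, 0, 0, -1), (-3, 0, 0, -2))),
    (23, [(6, -3, -2, 2), (-2, 2, 2, 0), (-4, 3, 4, -2), (4, -2, 0, 0)],
      ((1, 1, 1, 0), (3, 1, 1, 1)), ((-1, 1, 0, 0), (-3, 1, 0, -1))),
    (24, [(1, -1, 0, 0), (4, -3, -4, 2), (-1, 0, -2, 0), (1, -1, -2, 0), (3, -2, -4, 2), (-2, 1, 0, 0)],
      ((-3, 0, 0, -1), (-1, 0, 0, -1)), ((-1, 0, 0, -1), (-3, 0, 0, -1))),
    (26, [(0, 0, 0, 0), (-5, 3, 2, -2), (0, 0, -2, 0), (5, -3, -4, 2)],
      ((-3, 1, 0, -1), (-3, 1, 0, -1)), ((-1, 0, 0, 0), (-1, 0, 0, 0)))]"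

text \<open>The point \<open>pt a0 a1 a2 a3\<close> in the coordinates \<open>(X, Y)\<close>.\<close>

fun corner :: "int \<times> int \<times> int \<times> int \<Rightarrow> gold \<times> gold" where
  "corner (a0, a1, a2, a3) = (Gold a1 (a0 + a1), Gold a2 a3)"

text \<open>Under \<open>(X, Y) \<mapsto> (-X, -Y)\<close> every gap \<open>g\<close> becomes \<open>4 - g\<close> for
the mirrored itinerary, and \<open>jump\<close> changes sign. So the negative of a listed polygon
has the mirrored itineraries.\<close>

fun mirror :: "itinerary \<Rightarrow> itinerary" where
  "mirror (c1, c2, c3, c4) = (- c1 - 2, 1 - c2, - c3, - 1 - c4)"

definition polygon_table :: "polygon_row list" where
  "polygon_table = concat (map (\<lambda>(k, ps, p, m).
     (k, map corner ps, p, m) #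
     (if k \<in> {23, 26} then []
      else [(k + 1, map (map_prod uminus uminus \<circ> corner) ps,
             map_prod mirror mirror p, map_prod mirror mirror m)])) listed_table)"

text \<open>The weak inequalities at one vertex. They become strict in the interior of the polygon.\<close>

definition fits :: "itinerary \<Rightarrow> gold \<Rightarrow> gold \<Rightarrow> bool" where
  "fits c x y \<longleftrightarrow> list_all (\<lambda>(a, b, g). let z = a * x + b * y + g in
     gold_nonneg z \<and> gold_nonneg (Gold 4 0 - z)) (gap_forms c)"

text \<open>The first half trip has the itinerary \<open>c\<close>, the second one has the itinerary
\<open>d\<close> at the image of the vertex. The congruences keep track of the heights modulo 4,
where \<open>h\<close> is 1 or -1.\<close>

definition pair_fits :: "int \<Rightarrow> itinerary \<times> itinerary \<Rightarrow> (gold \<times> gold) list \<Rightarrow> bool" where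
  "pair_fits h = (\<lambda>(c, d) ps. (fst c - h) mod 4 = 0 \<and> (fst d - turns c h) mod 4 = 0 \<and>
     list_all (\<lambda>(x, y). fits c x y \<and> fits d (jump c - x) (y + jump c - (x + x))) ps)"

lemma polygon_table_fits:
  "list_all (\<lambda>(k, ps, p, m). pair_fits 1 p ps \<and> pair_fits (- 1) m ps) polygon_table"
  by code_simp

text \<open>A quantity that does not see the translation of an itinerary by \<open>shift\<close>, so that it
can be compared between different representatives of a point of the torus.\<close>

fun normalised :: "itinerary \<Rightarrow> itinerary \<Rightarrow> itinerary" where
  "normalised (b1, b2, b3, b4) (c1, c2, c3, c4) = (c1 - b1, c2 - b2, c3 - b2, c4 - b2)"

definition signature ::
    "(itinerary \<times> itinerary) \<times> (itinerary \<times> itinerary) \<Rightarrow> itinerary list" where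
  "signature = (\<lambda>((c, d), (c', d')). map (normalised c) [c, d, c', d'])"

text \<open>Exchanging \<open>p\<close> and \<open>m\<close> corresponds to changing the parity of the integer
\<open>j\<close> in \<open>t = Y + 2 j\<close>. Even up to this exchange no two of the 26 rows have the
same signature, and this makes the polygons disjoint on the points that carry an itinerary.\<close>

lemma signatures_distinct:
  "distinct (concat (map (\<lambda>(k, ps, p, m). [signature (p, m), signature (m, p)]) polygon_table))"
  by code_simp

lemma polygon_table_indices: "mset (map fst polygon_table) = mset [1..<27]"
  by code_simp

section \<open>From a polygon to an orbit\<close>

fun to_plane :: "gold \<times> gold \<Rightarrow> plane" where
  "to_plane (x, y) = (val x / (2 * phi), val y / 2)"

definition tile :: "(gold \<times> gold) list \<Rightarrow> plane set" where
  "tile ps = interior (convex hull (to_plane ` set ps))"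

text \<open>An affine function that is nonnegative at the vertices is nonnegative on the polygon, hence
positive at interior points unless it is constant. A dependence on the second coordinate excludes
the latter.\<close>

lemma affine_pos_on_tile:
  assumes b: "b \<noteq> 0" and ge: "\<And>x y. (x, y) \<in> set ps \<Longrightarrow> 0 \<le> a * val x + b * val y + g"
    and w: "w \<in> tile ps"
  shows "0 < a * (2 * phi * fst w) + b * (2 * snd w) + g"
proof -
  let ?n = "(2 * phi * a, 2 * b)"
  let ?S = "{z. ?n \<bullet> z \<ge> - g}"
  have phi: "phi > 0" using phi_bounds by simp
  have "to_plane (x, y) \<in> ?S" if "(x, y) \<in> set ps" for x y
    using ge[OF that] phi by (simp add: algebra_simps)
  then have "to_plane ` set ps \<subseteq> ?S" by (metis (no_types, lifting) image_subsetI surj_pair)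
  then have "convex hull (to_plane ` set ps) \<subseteq> ?S"
    by (intro hull_minimal convex_halfspace_ge)
  then have "w \<in> interior ?S" using w interior_mono unfolding tile_def by blast
  moreover have "?n \<noteq> 0" using b by (simp add: zero_prod_def)
  ultimately have "?n \<bullet> w > - g"
    using interior_halfspace_ge[of ?n "- g"] by auto
  then show ?thesis by (cases w) (simp add: algebra_simps)
qed

lemma gap_forms_slope: "(a, b, g) \<in> set (gap_forms c) \<Longrightarrow> val b \<noteq> 0"
  using phi_bounds by (cases c) auto

lemma fitsD:
  assumes "fits c x y" "(a, b, g) \<in> set (gap_forms c)"
  shows "0 \<le> val a * val x + val b * val y + val g" "val a * val x + val b * val y + val g \<le> 4"
proof -
  have "gold_nonneg (a * x + b * y + g)" "gold_nonneg (Gold 4 0 - (a * x + b * y + g))"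
    using assms by (auto simp: fits_def list_all_iff Let_def)
  from this[THEN gold_nonneg] show "0 \<le> val a * val x + val b * val y + val g"
    "val a * val x + val b * val y + val g \<le> 4" by simp_all
qed

lemma admissible_on_tile:
  assumes fit: "\<And>x y. (x, y) \<in> set ps \<Longrightarrow> fits c x y" and w: "w \<in> tile ps"
  shows "admissible c (2 * phi * fst w) (2 * snd w)"
  unfolding admissible_def
proof safe
  fix a b g assume F: "(a, b, g) \<in> set (gap_forms c)"
  note b = gap_forms_slope[OF F]
  show "0 < form_value (a, b, g) (2 * phi * fst w) (2 * snd w)"
    using affine_pos_on_tile[OF b _ w, of "val a" "val g"] fitsD(1)[OF fit F]
    by (simp add: form_value_def)
  show "form_value (a, b, g) (2 * phi * fst w) (2 * snd w) < 4"
    using affine_pos_on_tile[of "- val b" ps "- val a" "4 - val g", OF _ _ w] b fitsD(2)[OF fit F]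
    by (simp add: form_value_def algebra_simps)
qed

text \<open>The gaps of the second half trip are evaluated at the image under the first one, which is again an
affine function of the point.\<close>

lemma next_admissible_on_tile:
  assumes fit: "\<And>x y. (x, y) \<in> set ps \<Longrightarrow> fits d (s - x) (y + s - (x + x))" and w: "w \<in> tile ps"
  shows "admissible d (val s - 2 * phi * fst w) (2 * snd w + val s - 2 * (2 * phi * fst w))"
  unfolding admissible_def
proof safe
  fix a b g assume F: "(a, b, g) \<in> set (gap_forms d)"
  note b = gap_forms_slope[OF F]
  have 1: "val a * (val s - X) + val b * (Y + val s - 2 * X) + val g
      = (- val a - 2 * val b) * X + val b * Y + ((val a + val b) * val s + val g)" for X Y
    by (simp add: algebra_simps)
  have 2: "0 \<le> val a * (val s - val x) + val b * (val y + val s - 2 * val x) + val g"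
    "val a * (val s - val x) + val b * (val y + val s - 2 * val x) + val g \<le> 4"
    if "(x, y) \<in> set ps" for x y
    using fitsD[OF fit[OF that] F] by (simp_all add: algebra_simps)
  show "0 < form_value (a, b, g) (val s - 2 * phi * fst w) (2 * snd w + val s - 2 * (2 * phi * fst w))"
    unfolding form_value_def prod.case 1 using 2(1) unfolding 1
    by (intro affine_pos_on_tile[OF b _ w]) auto
  have 3: "4 - ((- val a - 2 * val b) * X + val b * Y + ((val a + val b) * val s + val g))
      = (val a + 2 * val b) * X + (- val b) * Y + (4 - (val a + val b) * val s - val g)" for X Y
    by (simp add: algebra_simps)
  have "0 \<le> (val a + 2 * val b) * val x + (- val b) * val y + (4 - (val a + val b) * val s - val g)"
    if "(x, y) \<in> set ps" for x y
    using 2(2)[OF that] by (simp add: algebra_simps)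
  then have "0 < (val a + 2 * val b) * (2 * phi * fst w) + (- val b) * (2 * snd w)
      + (4 - (val a + val b) * val s - val g)"
    using b by (intro affine_pos_on_tile[OF _ _ w]) auto
  then show "form_value (a, b, g) (val s - 2 * phi * fst w)
      (2 * snd w + val s - 2 * (2 * phi * fst w)) < 4"
    unfolding form_value_def prod.case 1 by (simp add: algebra_simps)
qed

text \<open>The pair of itineraries of two successive half trips from \<open>(t, e)\<close>. Both coordinates
are equal to \<open>t\<close>, that is, no translation has been split off.\<close>

definition trip :: "real \<Rightarrow> int \<Rightarrow> itinerary \<times> itinerary \<Rightarrow> bool" where
  "trip t e = (\<lambda>(c, d). admissible c t t \<and> 4 dvd fst c - e \<and>
     admissible d (val (jump c) - t) (val (jump c) - t) \<and> 4 dvd fst d - turns c e)"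

lemma turns_shift: "turns (shift i j c) e = turns c e"
  by (cases c) simp

lemma turns_neg: "turns c (- e) = - turns c e"
  by (cases c) simp

lemma fst_shift: "fst (shift i j c) = fst c + 2 * j"
  by (cases c) simp

lemma trip_on_tile:
  assumes pf: "pair_fits h p ps" and h: "h = (if even j then e else - e)"
    and e: "e = 1 \<or> e = -1"
    and w: "(t / (2 * phi) - of_int i, t / 2 - of_int j) \<in> tile ps"
  shows "trip t e (map_prod (shift i j) (shift i j) p)"
proof -
  obtain c d where p: "p = (c, d)" by (cases p)
  have phi: "phi > 0" using phi_bounds by simp
  let ?w = "(t / (2 * phi) - of_int i, t / 2 - of_int j)"
  let ?X = "t - 2 * phi * i" and ?Y = "t - 2 * j"
  have XY: "2 * phi * fst ?w = ?X" "2 * snd ?w = ?Y" using phi by (simp_all add: field_simps)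
  have "\<And>x y. (x, y) \<in> set ps \<Longrightarrow> fits c x y"
    "\<And>x y. (x, y) \<in> set ps \<Longrightarrow> fits d (jump c - x) (y + jump c - (x + x))"
    using pf by (auto simp: pair_fits_def p list_all_iff)
  then have a: "admissible c ?X ?Y" "admissible d (val (jump c) - ?X) (?Y + val (jump c) - 2 * ?X)"
    using admissible_on_tile[OF _ w] next_admissible_on_tile[OF _ w] unfolding XY by auto
  have "admissible (shift i j c) t t" using a(1) by (subst admissible_shift) auto
  moreover have "admissible (shift i j d) (val (jump (shift i j c)) - t) (val (jump (shift i j c)) - t)"
    using a(2) by (subst admissible_shift[of _ "val (jump c) - ?X" _ _ "?Y + val (jump c) - 2 * ?X"])
      (auto simp: val_jump_shift)
  moreover have "4 dvd fst (shift i j c) - e" "4 dvd fst (shift i j d) - turns (shift i j c) e"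
  proof -
    have dv: "(fst c - h) mod 4 = 0" "(fst d - turns c h) mod 4 = 0"
      using pf by (auto simp: pair_fits_def p)
    have t1: "turns c 1 = 1 \<or> turns c 1 = -1" by (cases c) auto
    show "4 dvd fst (shift i j c) - e"
      using dv(1) h e unfolding fst_shift by (auto split: if_splits) presburger+
    show "4 dvd fst (shift i j d) - turns (shift i j c) e"
      using dv(2) h e t1 turns_neg[of c 1] unfolding fst_shift turns_shift
      by (auto split: if_splits) presburger+
  qed
  ultimately show ?thesis by (simp add: trip_def p)
qed

lemma trip_unique:
  assumes "trip t e p" "trip t e q"
  shows "p = q"
proof -
  obtain c d c' d' where pq: "p = (c, d)" "q = (c', d')" by (metis prod.exhaust)
  have "4 dvd fst c - fst c'"
    using assms dvd_diff[of 4 "fst c - e" "fst c' - e"] by (simp add: trip_def pq)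
  then have c: "c = c'" using assms by (auto simp: trip_def pq intro: admissible_unique)
  have "4 dvd fst d - fst d'"
    using assms dvd_diff[of 4 "fst d - turns c e" "fst d' - turns c e"] by (simp add: trip_def pq c)
  then have "d = d'" using assms by (auto simp: trip_def pq c intro: admissible_unique)
  then show ?thesis by (simp add: pq c)
qed

section \<open>The return map and the arithmetic graph\<close>

text \<open>The form \<open>a * a + a * b - b * b\<close> is the norm of \<open>a + b * phi\<close>. It has no
nontrivial zero modulo 2, so a zero could be halved forever.\<close>

lemma golden_norm_zero:
  fixes a b :: int
  assumes "a * a + a * b = b * b"
  shows "a = 0 \<and> b = 0"
  using assms
proof (induction "nat \<bar>a\<bar> + nat \<bar>b\<bar>" arbitrary: a b rule: less_induct)
  case less
  have "even a \<and> even b"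
    using less.prems by (metis even_add even_mult_iff)
  then obtain a' b' where ab: "a = 2 * a'" "b = 2 * b'" by (auto elim!: evenE)
  show ?case
  proof (rule ccontr)
    assume "\<not> ?case"
    then have "nat \<bar>a'\<bar> + nat \<bar>b'\<bar> < nat \<bar>a\<bar> + nat \<bar>b\<bar>" using ab by auto
    moreover have "a' * a' + a' * b' = b' * b'" using less.prems ab by simp
    ultimately have "a' = 0 \<and> b' = 0" by (rule less.hyps)
    then show False using \<open>\<not> ?case\<close> ab by simp
  qed
qed

lemma val_eq_0: "val (Gold a b) = 0 \<longleftrightarrow> a = 0 \<and> b = 0"
proof
  assume z: "val (Gold a b) = 0"
  have "val (Gold (a * a + a * b - b * b) 0) = val (Gold a b * Gold (a + b) (- b))"
    by (simp add: algebra_simps)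
  also have "\<dots> = 0" using z by (simp only: val_simps mult_zero_left)
  finally have "real_of_int (a * a + a * b - b * b) = 0" by simp
  then have "a * a + a * b = b * b" by (simp only: of_int_eq_0_iff)
  then show "a = 0 \<and> b = 0" by (rule golden_norm_zero)
qed simp

lemma T_map_val: "T_map (of_int x, of_int y) = val (Gold (2 - 6 * x + 2 * y) (4 * x - 1))"
  by (simp add: T_map_def kite_A_phi field_simps)

lemma lattice_iff: "z \<in> lattice \<longleftrightarrow> (\<exists>x y. z = (of_int x, of_int y))"
  by (cases z) (auto simp: lattice_def elim!: Ints_cases)

lemma T_map_inj: "z \<in> lattice \<Longrightarrow> w \<in> lattice \<Longrightarrow> T_map z = T_map w \<Longrightarrow> z = w"
proof -
  assume z: "z \<in> lattice" and w: "w \<in> lattice" and eq: "T_map z = T_map w"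
  obtain a b c d where zw: "z = (of_int a, of_int b)" "w = (of_int c, of_int d)"
    using z w unfolding lattice_iff by blast
  have "val (Gold (2 * (b - d) - 6 * (a - c)) (4 * (a - c))) = 0"
    using eq unfolding zw T_map_val by (simp add: algebra_simps)
  then show "z = w" unfolding val_eq_0 zw by simp
qed

fun displacement :: "itinerary \<times> itinerary \<Rightarrow> plane" where
  "displacement ((c1, c2, c3, c4), (d1, d2, d3, d4)) =
     (of_int (d3 - c3), of_int (d2 + d3 + d4 - (c2 + c3 + c4)))"

lemma displacement_lattice: "displacement p \<in> lattice"
  by (cases p rule: displacement.cases) (simp add: lattice_def)

lemma displacement_shift: "displacement (map_prod (shift i j) (shift i j) p) = displacement p"
  by (cases p rule: displacement.cases) simp

lemma T_map_displacement: "T_map (z + displacement (c, d)) = T_map z + val (jump d) - val (jump c)"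
proof -
  obtain c1 c2 c3 c4 d1 d2 d3 d4 where "c = (c1, c2, c3, c4)" "d = (d1, d2, d3, d4)"
    by (metis prod.exhaust)
  then show ?thesis by (cases z) (simp add: T_map_def kite_A_phi algebra_simps)
qed

lemma lattice_add: "z \<in> lattice \<Longrightarrow> w \<in> lattice \<Longrightarrow> z + w \<in> lattice"
  by (auto simp: lattice_def)

text \<open>Two half trips take \<open>t\<close> to \<open>jump d - (jump c - t)\<close>, and the difference of the
two jumps is the value of the linear part of \<open>T_map\<close> at an integer vector.\<close>

lemma Upsilon_R_trip:
  assumes x: "x \<in> lattice \<inter> H" and e: "e = 1 \<or> e = -1" and trip: "trip (T_map x) e p"
  shows "x + displacement p \<in> lattice \<inter> H"
    and "\<exists>e'\<in>{-1, 1}. Upsilon_R (T_map x, of_int e) = Some (T_map (x + displacement p), e')"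
proof -
  obtain c d where p: "p = (c, d)" by (cases p)
  let ?t = "T_map x" and ?t' = "val (jump c) - T_map x"
  let ?t'' = "T_map (x + displacement p)"
  have tr: "turns c z = z \<or> turns c z = - z" for c z by (cases c) auto
  have t: "0 < ?t" using x by (simp add: H_def)
  have h1: "half_trip (?t, of_int e) (?t', of_int (turns c e))"
    using trip e t by (intro half_trip_admissible) (auto simp: trip_def p)
  then have t': "0 < ?t'" by (simp add: half_trip_def axis_rays_iff)
  have e': "turns c e = 1 \<or> turns c e = -1" using e tr[of c e] by auto
  have t'': "?t'' = val (jump d) - ?t'" unfolding p T_map_displacement by simp
  have h2: "half_trip (?t', of_int (turns c e)) (?t'', of_int (turns d (turns c e)))"
    unfolding t'' using trip e' t' by (intro half_trip_admissible) (auto simp: trip_def p)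
  then have pos: "0 < ?t''" by (simp add: half_trip_def axis_rays_iff)
  have e'': "turns d (turns c e) = 1 \<or> turns d (turns c e) = -1" using e' tr[of d "turns c e"] by auto
  have lat: "x + displacement p \<in> lattice" using x displacement_lattice lattice_add by blast
  then show "x + displacement p \<in> lattice \<inter> H" using pos by (simp add: H_def)
  have "(?t, of_int e) \<in> C_pm" "(?t'', of_int (turns d (turns c e))) \<in> C_pm"
    using x t e lat pos e'' by (auto simp: C_pm_def)
  then have "Upsilon_R (?t, of_int e) = Some (?t'', of_int (turns d (turns c e)))"
    by (rule first_return_two_half_trips[OF h1 h2])
  then show "\<exists>e'\<in>{-1, 1}. Upsilon_R (?t, of_int e) = Some (?t'', e')" using e'' by auto
qed

lemma translated_pair:
  fixes x a b :: "'a::ab_group_add"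
  shows "{x' - x |x'. x' \<noteq> x \<and> (x' = x + a \<or> x' = x + b)} = {a, b} - {0}"
  by (auto intro: exI[of _ "x + a"] exI[of _ "x + b"])

lemma local_type_trips:
  assumes x: "x \<in> lattice \<inter> H" and p: "trip (T_map x) 1 p" and m: "trip (T_map x) (-1) m"
  shows "local_type x = {displacement p, displacement m} - {0}"
proof -
  note ends = Upsilon_R_trip(1)[OF x _ p] Upsilon_R_trip(1)[OF x _ m]
  obtain a where a: "a \<in> {-1, 1}" "Upsilon_R (T_map x, 1) = Some (T_map (x + displacement p), a)"
    using Upsilon_R_trip(2)[OF x _ p] by auto
  obtain b where b: "b \<in> {-1, 1}" "Upsilon_R (T_map x, -1) = Some (T_map (x + displacement m), b)"
    using Upsilon_R_trip(2)[OF x _ m] by auto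
  have "joined x x' \<longleftrightarrow> x' \<noteq> x \<and> (x' = x + displacement p \<or> x' = x + displacement m)" for x'
  proof (cases "x' \<in> lattice \<inter> H")
    case True
    have "T_map (x + displacement p) = T_map x' \<longleftrightarrow> x' = x + displacement p"
      "T_map (x + displacement m) = T_map x' \<longleftrightarrow> x' = x + displacement m"
      using T_map_inj True ends by (metis IntD1)+
    moreover have "(\<exists>e1\<in>{-1, 1}. \<exists>e2\<in>{-1, 1}. Upsilon_R (T_map x, e1) = Some (T_map x', e2)) \<longleftrightarrow>
        T_map (x + displacement p) = T_map x' \<or> T_map (x + displacement m) = T_map x'"
      using a b by (simp only: bex_simps insert_iff empty_iff option.inject prod.inject) blast
    ultimately show ?thesis unfolding joined_def using True x by blast
  next
    case False
    then show ?thesis unfolding joined_def using ends by blast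
  qed
  then have "local_type x = {x' - x |x'. x' \<noteq> x \<and> (x' = x + displacement p \<or> x' = x + displacement m)}"
    unfolding local_type_def by simp
  also have "\<dots> = {displacement p, displacement m} - {0}" by (rule translated_pair)
  finally show ?thesis .
qed

section \<open>The polygons cover the torus\<close>

fun edge :: "gold \<times> gold \<Rightarrow> gold \<times> gold \<Rightarrow> gold \<times> gold \<times> gold" where
  "edge (x1, y1) (x2, y2) = (y1 - y2, x2 - x1, (y2 - y1) * x1 - (x2 - x1) * y1)"

fun gold_form :: "gold \<times> gold \<times> gold \<Rightarrow> gold \<times> gold \<Rightarrow> gold" where
  "gold_form (a, b, g) (x, y) = a * x + b * y + g"

lemma val_gold_form: "val (gold_form F (x, y)) = form_value F (val x) (val y)"
  by (cases F) (simp add: form_value_def)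

fun chain_edges :: "gold \<times> gold \<Rightarrow> (gold \<times> gold) list \<Rightarrow> gold \<times> gold \<Rightarrow> (gold \<times> gold \<times> gold) list" where
  "chain_edges q [] p = [edge q p]" |
  "chain_edges q (r # rs) p = edge q r # chain_edges r rs p"

fun polygon_edges :: "(gold \<times> gold) list \<Rightarrow> (gold \<times> gold \<times> gold) list" where
  "polygon_edges [] = []" |
  "polygon_edges (p # ps) = chain_edges p ps p"

fun fan_positive :: "gold \<times> gold \<Rightarrow> (gold \<times> gold) list \<Rightarrow> bool" where
  "fan_positive p (q # r # rs) \<longleftrightarrow> gold_pos (gold_form (edge p q) r) \<and> fan_positive p (r # rs)" |
  "fan_positive p _ \<longleftrightarrow> True"

lemma edge_reverse: "form_value (edge q p) X Y = - form_value (edge p q) X Y"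
  by (cases p; cases q) (simp add: form_value_def algebra_simps)

text \<open>The values of the three edge forms at a point are, up to a common factor, its barycentric
coordinates.\<close>

lemma in_triangle:
  assumes "0 < val (gold_form (edge p q) r)"
    and "0 \<le> form_value (edge p q) (2 * phi * fst w) (2 * snd w)"
    and "0 \<le> form_value (edge q r) (2 * phi * fst w) (2 * snd w)"
    and "0 \<le> form_value (edge r p) (2 * phi * fst w) (2 * snd w)"
  shows "w \<in> convex hull {to_plane p, to_plane q, to_plane r}"
proof -
  obtain px py qx qy rx ry where pqr: "p = (px, py)" "q = (qx, qy)" "r = (rx, ry)"
    by (metis prod.exhaust)
  obtain u v where w: "w = (u, v)" by (cases w)
  have phi: "phi > 0" using phi_bounds by simp
  define X where "X = 2 * phi * u"
  define Y where "Y = 2 * v"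
  define a b c where abc: "a = form_value (edge q r) X Y"
    "b = form_value (edge r p) X Y" "c = form_value (edge p q) X Y"
  define D where "D = val (gold_form (edge p q) r)"
  have D: "D > 0" "D = a + b + c" and
    X: "D * X = a * val px + b * val qx + c * val rx" and
    Y: "D * Y = a * val py + b * val qy + c * val ry"
    using assms(1) unfolding abc D_def pqr
    by (simp_all add: form_value_def algebra_simps)
  have pos: "0 \<le> a" "0 \<le> b" "0 \<le> c" using assms(2-4) by (simp_all add: abc X_def Y_def w)
  have D_sum: "D * (a / D * x + b / D * y + c / D * z) = a * x + b * y + c * z" for x y z
    using D(1) by (simp add: distrib_left)
  have "D * u = a * (val px / (2 * phi)) + b * (val qx / (2 * phi)) + c * (val rx / (2 * phi))"
    using X phi by (simp add: X_def field_simps)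
  then have u: "u = a / D * (val px / (2 * phi)) + b / D * (val qx / (2 * phi)) + c / D * (val rx / (2 * phi))"
    using D(1) unfolding D_sum[symmetric] by simp
  have "D * v = a * (val py / 2) + b * (val qy / 2) + c * (val ry / 2)"
    using Y by (simp add: Y_def)
  then have v: "v = a / D * (val py / 2) + b / D * (val qy / 2) + c / D * (val ry / 2)"
    using D(1) unfolding D_sum[symmetric] by simp
  have "w = (a / D) *\<^sub>R to_plane p + (b / D) *\<^sub>R to_plane q + (c / D) *\<^sub>R to_plane r"
    unfolding w pqr by (subst u, subst v) simp
  moreover have "a / D + b / D + c / D = 1" using D by (simp flip: add_divide_distrib)
  ultimately show ?thesis using pos D(1) unfolding convex_hull_3
    by (metis (mono_tags, lifting) divide_nonneg_pos mem_Collect_eq)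
qed

text \<open>A fan of diagonals from the vertex \<open>p\<close> cuts the polygon into triangles: the point
lies in the first one or beyond the first diagonal.\<close>

lemma in_fan:
  assumes "fan_positive p (q # rs)" "rs \<noteq> []"
    and "0 \<le> form_value (edge p q) (2 * phi * fst w) (2 * snd w)"
    and "\<forall>F\<in>set (chain_edges q rs p). 0 \<le> form_value F (2 * phi * fst w) (2 * snd w)"
  shows "w \<in> convex hull (to_plane ` set (p # q # rs))"
  using assms
proof (induction rs arbitrary: q)
  case Nil
  then show ?case by simp
next
  case (Cons r rs)
  let ?X = "2 * phi * fst w" and ?Y = "2 * snd w"
  have D: "0 < val (gold_form (edge p q) r)" using Cons.prems(1) gold_pos by simp
  show ?case
  proof (cases "0 \<le> form_value (edge r p) ?X ?Y")
    case True
    have "w \<in> convex hull {to_plane p, to_plane q, to_plane r}"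
      using Cons.prems True D by (intro in_triangle) auto
    moreover have "convex hull {to_plane p, to_plane q, to_plane r}
        \<subseteq> convex hull (to_plane ` set (p # q # r # rs))"
      by (intro hull_mono) auto
    ultimately show ?thesis by blast
  next
    case False
    then have "0 \<le> form_value (edge p r) ?X ?Y" using edge_reverse[of r p ?X ?Y] by simp
    moreover have "rs \<noteq> []" using False Cons.prems(4) by auto
    ultimately have "w \<in> convex hull (to_plane ` set (p # r # rs))"
      using Cons.prems by (intro Cons.IH) auto
    moreover have "convex hull (to_plane ` set (p # r # rs))
        \<subseteq> convex hull (to_plane ` set (p # q # r # rs))"
      by (intro hull_mono) auto
    ultimately show ?thesis by blast
  qed
qed

lemma continuous_form: "continuous_on UNIV (\<lambda>w. form_value F (2 * phi * fst w) (2 * snd w))"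
  by (cases F) (auto simp: form_value_def intro!: continuous_intros)

lemma in_tile:
  assumes fan: "fan_positive p (q # rs)" "rs \<noteq> []"
    and edges: "\<forall>F\<in>set (polygon_edges (p # q # rs)). 0 < form_value F (2 * phi * fst w) (2 * snd w)"
  shows "w \<in> tile (p # q # rs)"
proof -
  let ?E = "set (polygon_edges (p # q # rs))"
  let ?S = "\<Inter>F\<in>?E. {w. 0 < form_value F (2 * phi * fst w) (2 * snd w)}"
  have "open ?S"
    by (intro open_INT finite_set ballI open_Collect_less continuous_on_const continuous_form)
  moreover have "?S \<subseteq> convex hull (to_plane ` set (p # q # rs))"
  proof
    fix z assume "z \<in> ?S"
    then have "\<forall>F\<in>?E. 0 \<le> form_value F (2 * phi * fst z) (2 * snd z)" by (blast intro: less_imp_le)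
    then show "z \<in> convex hull (to_plane ` set (p # q # rs))" using fan by (intro in_fan) auto
  qed
  ultimately have "?S \<subseteq> interior (convex hull (to_plane ` set (p # q # rs)))"
    by (rule interior_maximal[rotated])
  then show ?thesis using edges unfolding tile_def by blast
qed

text \<open>A point strictly between two lines and between two heights is a convex combination, with four
positive weights, of the corners of the trapezoid that they bound. The trapezoid may degenerate to a
triangle.\<close>

lemma form_pos_trapezoid:
  fixes y0 y1 :: real
  assumes y: "y0 < Y" "Y < y1"
    and left: "0 < (y1 - y0) * (X - b) - (t - b) * (Y - y0)"
    and right: "(y1 - y0) * (X - b') - (t' - b') * (Y - y0) < 0"
    and corners: "0 \<le> form_value F b y0" "0 \<le> form_value F t y1"
      "0 \<le> form_value F b' y0" "0 \<le> form_value F t' y1"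
    and strict: "0 < form_value F b y0 \<or> 0 < form_value F t y1 \<or>
      0 < form_value F b' y0 \<or> 0 < form_value F t' y1"
  shows "0 < form_value F X Y"
proof -
  define h where "h = y1 - y0"
  define s where "s = (Y - y0) / h"
  define L where "L = b + (t - b) * s"
  define R where "R = b' + (t' - b') * s"
  have h: "h > 0" using y by (simp add: h_def)
  have s: "0 < s" "s < 1" "Y = y0 + s * h" using y h by (simp_all add: s_def h_def field_simps)
  have "h * (X - L) = h * (X - b) - (t - b) * (Y - y0)" "h * (X - R) = h * (X - b') - (t' - b') * (Y - y0)"
    using h by (simp_all add: L_def R_def s_def field_simps)
  then have "0 < h * (X - L)" "h * (X - R) < 0" using left right by (simp_all add: h_def)
  then have LR: "L < X" "X < R" using h by (simp_all add: zero_less_mult_iff mult_less_0_iff)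
  define r where "r = (X - L) / (R - L)"
  have r: "0 < r" "r < 1" "X = L + r * (R - L)" using LR by (simp_all add: r_def field_simps)
  obtain \<alpha> \<beta> \<gamma> where F: "\<And>X Y. form_value F X Y = \<alpha> * X + \<beta> * Y + \<gamma>"
    by (cases F) (auto simp: form_value_def)
  have "form_value F X Y = (1 - s) * (1 - r) * form_value F b y0 + s * (1 - r) * form_value F t y1
      + (1 - s) * r * form_value F b' y0 + s * r * form_value F t' y1"
    unfolding F r(3) s(3) L_def R_def h_def by (simp add: algebra_simps)
  moreover have w: "0 < (1 - s) * (1 - r)" "0 < s * (1 - r)" "0 < (1 - s) * r" "0 < s * r"
    using r s by simp_all
  have "0 \<le> (1 - s) * (1 - r) * form_value F b y0" "0 \<le> s * (1 - r) * form_value F t y1"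
    "0 \<le> (1 - s) * r * form_value F b' y0" "0 \<le> s * r * form_value F t' y1"
    using w corners by (simp_all add: less_imp_le)
  moreover have "0 < (1 - s) * (1 - r) * form_value F b y0 \<or> 0 < s * (1 - r) * form_value F t y1 \<or>
    0 < (1 - s) * r * form_value F b' y0 \<or> 0 < s * r * form_value F t' y1"
    using strict w by (metis mult_pos_pos)
  ultimately show ?thesis by linarith
qed

text \<open>Horizontal lines through the vertices cut the torus into slabs, in which every polygon is a union of
trapezoids. A slab consists of the two heights, a list of cells from left to right, and the line at
its right end. A line is given by its first coordinates at the lower and at the upper height. With
its left line, a cell carries the index of the polygon that contains it and the translation in
\<open>(i, j)\<close>. By central symmetry the heights between 0 and \<open>2 * phi - 2\<close> suffice.\<close>

type_synonym slab = "gold \<times> gold \<times> ((gold \<times> gold) \<times> nat \<times> int \<times> int) list \<times> (gold \<times> gold)"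

definition slab_table :: "slab list" where
  "slab_table = [
    (Gold 0 0, Gold (-6) 4,
      [((Gold 0 0, Gold (-8) 5), 5, 0, 0),
       ((Gold 0 0, Gold (-3) 2), 3, 0, 0),
       ((Gold (-3) 2, Gold (-6) 4), 1, 0, 0),
       ((Gold (-1) 1, Gold (-6) 4), 25, 0, 0),
       ((Gold 1 0, Gold (-2) 2), 20, 0, -1),
       ((Gold (-2) 2, Gold (-10) 7), 23, 0, 0),
       ((Gold (-2) 2, Gold (-5) 4), 7, 0, -1),
       ((Gold 0 1, Gold (-8) 6), 24, 1, 1),
       ((Gold (-1) 2, Gold (-4) 4), 21, 1, 0),
       ((Gold 1 1, Gold (-4) 4), 9, 1, 1),
       ((Gold (-2) 3, Gold (-10) 8), 12, 1, 0),
       ((Gold 0 2, Gold (-5) 5), 26, 1, 1)],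
      (Gold 0 2, Gold (-8) 7)),
    (Gold (-6) 4, Gold 4 (-2),
      [((Gold (-8) 5, Gold 5 (-3)), 15, 0, 0),
       ((Gold (-3) 2, Gold 2 (-1)), 13, 0, 0),
       ((Gold (-6) 4, Gold 2 (-1)), 25, 0, 0),
       ((Gold (-2) 2, Gold 3 (-1)), 20, 0, -1),
       ((Gold (-10) 7, Gold 3 (-1)), 23, 0, 0),
       ((Gold (-5) 4, Gold 0 1), 17, 1, 1),
       ((Gold (-8) 6, Gold 5 (-2)), 24, 1, 1),
       ((Gold (-4) 4, Gold 1 1), 9, 1, 1),
       ((Gold (-10) 8, Gold 3 0), 12, 1, 0),
       ((Gold (-5) 5, Gold 3 0), 26, 1, 1)],
      (Gold (-8) 7, Gold 5 (-1))),
    (Gold 4 (-2), Gold (-2) 2,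
      [((Gold 5 (-3), Gold (-3) 2), 15, 0, 0),
       ((Gold 2 (-1), Gold (-3) 2), 10, 0, 0),
       ((Gold 2 (-1), Gold (-1) 1), 25, 0, 0),
       ((Gold 3 (-1), Gold (-5) 4), 18, 0, 0),
       ((Gold 3 (-1), Gold 0 1), 23, 0, 0),
       ((Gold 0 1, Gold (-3) 3), 17, 1, 1),
       ((Gold 5 (-2), Gold (-3) 3), 24, 1, 1),
       ((Gold 1 1, Gold (-2) 3), 9, 1, 1),
       ((Gold 3 0, Gold (-2) 3), 16, 1, 1),
       ((Gold 3 0, Gold (-5) 5), 26, 1, 1)],
      (Gold 5 (-1), Gold (-3) 4))]"

text \<open>For \<open>opposite k = (k', i, j)\<close>, the negative of polygon \<open>k\<close> is polygon
\<open>k'\<close> translated by \<open>(i, j)\<close>. The polygons 23 and 26 are centrally symmetric on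
the torus, about points different from 0, whence their translations.\<close>

definition opposite :: "nat \<Rightarrow> nat \<times> int \<times> int" where
  "opposite k = (if k = 23 then (23, - 1, - 1) else if k = 26 then (26, 0, 1)
     else if k = 24 then (25, 0, 0) else if k = 25 then (24, 0, 0)
     else if odd k then (k + 1, 0, 0) else (k - 1, 0, 0))"

definition corners_inside :: "nat \<times> int \<times> int \<Rightarrow> (gold \<times> gold) list \<Rightarrow> bool" where
  "corners_inside = (\<lambda>(k, i, j) zs. (case map_of polygon_table k of None \<Rightarrow> False | Some (ps, _) \<Rightarrow>
     list_all (\<lambda>F. let vs = map (\<lambda>(x, y). gold_form F (x - Gold 0 (2 * i), y - Gold (2 * j) 0)) zs in
       list_all gold_nonneg vs \<and> list_ex gold_pos vs) (polygon_edges ps)))"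

text \<open>The negative of the cell is tested as well, against the opposite polygon.\<close>

definition cell_ok :: "gold \<Rightarrow> gold \<Rightarrow> gold \<times> gold \<Rightarrow> gold \<times> gold \<Rightarrow> nat \<times> int \<times> int \<Rightarrow> bool" where
  "cell_ok y0 y1 = (\<lambda>(b, t) (b', t') (k, i, j).
     let zs = [(b, y0), (t, y1), (b', y0), (t', y1)] in
     corners_inside (k, i, j) zs \<and>
     (case opposite k of (k', i', j') \<Rightarrow>
        corners_inside (k', i' - i, j' - j) (map (map_prod uminus uminus) zs)))"

text \<open>Positive to the right of the line through the given points at heights \<open>y0\<close> and
\<open>y1\<close>.\<close>

fun side :: "gold \<Rightarrow> gold \<Rightarrow> gold \<times> gold \<Rightarrow> gold \<times> gold \<times> gold" where
  "side y0 y1 (b, t) = (y1 - y0, b - t, (t - b) * y0 - (y1 - y0) * b)"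

fun even_gold :: "gold \<Rightarrow> bool" where
  "even_gold (Gold a b) \<longleftrightarrow> even a \<and> even b"

text \<open>A congruence test, modulo 2 or 4, which implies that the form has no zero at the points of
\<open>half_odd\<close> coordinates below. For those, the form evaluates to the number tested here plus
twice an integer combination of its coefficients \<open>c\<close> and \<open>d\<close>.\<close>

fun nonzero_form :: "gold \<times> gold \<times> gold \<Rightarrow> bool" where
  "nonzero_form (c, d, e) = (case (c + d) * Gold 2 (- 1) + e of Gold a b \<Rightarrow>
     odd a \<or> odd b \<or> even_gold c \<and> even_gold d \<and> (a mod 4 \<noteq> 0 \<or> b mod 4 \<noteq> 0))"

fun cells_ok :: "gold \<Rightarrow> gold \<Rightarrow> ((gold \<times> gold) \<times> nat \<times> int \<times> int) list \<Rightarrow> gold \<times> gold \<Rightarrow> bool" where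
  "cells_ok y0 y1 [] l = nonzero_form (side y0 y1 l)" |
  "cells_ok y0 y1 ((l, k) # cs) l' \<longleftrightarrow> nonzero_form (side y0 y1 l) \<and>
     cell_ok y0 y1 l (if cs = [] then l' else fst (hd cs)) k \<and> cells_ok y0 y1 cs l'"

definition slab_ok :: "slab \<Rightarrow> bool" where
  "slab_ok = (\<lambda>(y0, y1, cs, (b, t)). cells_ok y0 y1 cs (b, t) \<and> cs \<noteq> [] \<and>
     fst (hd cs) = (b - Gold 0 2, t - Gold 0 2))"

lemma slab_table_ok: "list_all slab_ok slab_table"
  by code_simp

lemma polygon_table_fans:
  "list_all (\<lambda>(k, ps, _). length ps \<ge> 3 \<and> fan_positive (hd ps) (tl ps)) polygon_table"
  by code_simp

text \<open>Stated through affine forms, so that it passes to translated and to negated corners without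
another look at the geometry.\<close>

definition enclosed :: "(gold \<times> gold) list \<Rightarrow> real \<Rightarrow> real \<Rightarrow> bool" where
  "enclosed zs X Y \<longleftrightarrow> (\<forall>F. (\<forall>z\<in>set zs. 0 \<le> val (gold_form F z)) \<longrightarrow>
     (\<exists>z\<in>set zs. 0 < val (gold_form F z)) \<longrightarrow> 0 < form_value F X Y)"

lemma enclosed_uminus:
  assumes "enclosed zs X Y"
  shows "enclosed (map (map_prod uminus uminus) zs) (- X) (- Y)"
  unfolding enclosed_def
proof (intro allI impI)
  fix F :: "gold \<times> gold \<times> gold"
  obtain a b g where F: "F = (a, b, g)" by (metis prod.exhaust)
  have eq: "val (gold_form F (map_prod uminus uminus z)) = val (gold_form (- a, - b, g) z)" for z
    by (cases z) (simp add: F)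
  assume "\<forall>z\<in>set (map (map_prod uminus uminus) zs). 0 \<le> val (gold_form F z)"
    "\<exists>z\<in>set (map (map_prod uminus uminus) zs). 0 < val (gold_form F z)"
  then have "\<forall>z\<in>set zs. 0 \<le> val (gold_form (- a, - b, g) z)"
    "\<exists>z\<in>set zs. 0 < val (gold_form (- a, - b, g) z)"
    unfolding set_map bex_simps ball_simps eq by simp_all
  then have "0 < form_value (- a, - b, g) X Y" using assms unfolding enclosed_def by blast
  then show "0 < form_value F (- X) (- Y)" by (simp add: F form_value_def)
qed

lemma corners_inside_tile:
  assumes inside: "corners_inside (k, i, j) zs" and enc: "enclosed zs X Y"
  shows "\<exists>ps pm. (k, ps, pm) \<in> set polygon_table \<and> (X / (2 * phi) - i, Y / 2 - j) \<in> tile ps"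
proof -
  have phi: "phi > 0" using phi_bounds by simp
  obtain ps pm where row: "map_of polygon_table k = Some (ps, pm)"
    using inside by (auto simp: corners_inside_def split: option.splits)
  let ?w = "(X / (2 * phi) - of_int i, Y / 2 - of_int j)"
  have in_table: "(k, ps, pm) \<in> set polygon_table" using row by (rule map_of_SomeD)
  have fan: "length ps \<ge> 3" "fan_positive (hd ps) (tl ps)"
    using polygon_table_fans in_table by (auto simp: list_all_iff)
  obtain p q rs where ps: "ps = p # q # rs" "rs \<noteq> []"
    using fan(1) by (cases ps; cases "tl ps"; cases "tl (tl ps)") auto
  have "0 < form_value F (2 * phi * fst ?w) (2 * snd ?w)" if F_edge: "F \<in> set (polygon_edges ps)" for F
  proof -
    obtain a b g where F: "F = (a, b, g)" by (metis prod.exhaust)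
    let ?F = "(a, b, g - a * Gold 0 (2 * i) - b * Gold (2 * j) 0)"
    let ?f = "\<lambda>z. gold_form F (fst z - Gold 0 (2 * i), snd z - Gold (2 * j) 0)"
    have eq: "val (?f z) = val (gold_form ?F z)" for z
      by (cases z) (simp add: F algebra_simps)
    have "list_all gold_nonneg (map ?f zs)" "list_ex gold_pos (map ?f zs)"
      using inside F_edge by (auto simp: corners_inside_def row list_all_iff Let_def split_def)
    then have "\<forall>z\<in>set zs. 0 \<le> val (?f z)" "\<exists>z\<in>set zs. 0 < val (?f z)"
      using gold_nonneg gold_pos by (auto simp: list_all_iff list_ex_iff)
    then have "0 < form_value ?F X Y" using enc unfolding eq enclosed_def by blast
    then show ?thesis using phi by (simp add: F form_value_def algebra_simps)
  qed
  then have "?w \<in> tile ps" using fan ps by (auto intro!: in_tile)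
  then show ?thesis using in_table by blast
qed

text \<open>The residue class of \<open>2 - phi\<close> modulo 2. It contains the coordinates \<open>X\<close> and
\<open>Y\<close> of all lattice points: 2 and \<open>2 * phi\<close> are zero modulo 2. No such point
lies on the boundary of a polygon.\<close>

definition half_odd :: "gold \<Rightarrow> bool" where
  "half_odd x \<longleftrightarrow> (\<exists>m n. x = Gold (2 + 2 * m) (2 * n - 1))"

lemma half_odd_shift:
  "half_odd x \<Longrightarrow> half_odd (x - Gold (2 * m) (2 * n))"
  unfolding half_odd_def
proof safe
  fix m' n' :: int
  have "Gold (2 + 2 * m') (2 * n' - 1) - Gold (2 * m) (2 * n) = Gold (2 + 2 * (m' - m)) (2 * (n' - n) - 1)"
    by (simp add: algebra_simps)
  then show "\<exists>ma na. Gold (2 + 2 * m') (2 * n' - 1) - Gold (2 * m) (2 * n) = Gold (2 + 2 * ma) (2 * na - 1)"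
    by blast
qed

lemma half_odd_uminus: "half_odd x \<Longrightarrow> half_odd (- x)"
  unfolding half_odd_def
proof safe
  fix m n :: int
  have "- Gold (2 + 2 * m) (2 * n - 1) = Gold (2 + 2 * (- 2 - m)) (2 * (1 - n) - 1)"
    by (simp add: algebra_simps)
  then show "\<exists>m' n'. - Gold (2 + 2 * m) (2 * n - 1) = Gold (2 + 2 * m') (2 * n' - 1)" by blast
qed

lemma half_odd_val_neq:
  assumes "half_odd x" "even b"
  shows "val x \<noteq> val (Gold a b)"
proof
  assume eq: "val x = val (Gold a b)"
  obtain m n where "x = Gold (2 + 2 * m) (2 * n - 1)" using assms(1) by (auto simp: half_odd_def)
  then have "val (Gold (2 + 2 * m - a) (2 * n - 1 - b)) = 0"
    using eq by (simp add: algebra_simps)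
  then show False unfolding val_eq_0 using assms(2) by presburger
qed

lemma nonzero_form:
  assumes "half_odd x" "half_odd y" "nonzero_form F"
  shows "form_value F (val x) (val y) \<noteq> 0"
proof
  assume z: "form_value F (val x) (val y) = 0"
  obtain m n m' n' where x: "x = Gold (2 + 2 * m) (2 * n - 1)" and y: "y = Gold (2 + 2 * m') (2 * n' - 1)"
    using assms(1,2) by (auto simp: half_odd_def)
  obtain c0 c1 d0 d1 e0 e1 where F: "F = (Gold c0 c1, Gold d0 d1, Gold e0 e1)"
    by (metis gold.exhaust prod.exhaust)
  define a where "a = 2 * (c0 + d0) - (c1 + d1) + e0"
  define b where "b = (c1 + d1) - (c0 + d0) + e1"
  define U where "U = c0 * m + c1 * n + d0 * m' + d1 * n'"
  define V where "V = c0 * n + c1 * m + c1 * n + d0 * n' + d1 * m' + d1 * n'"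
  have r: "(Gold c0 c1 + Gold d0 d1) * Gold 2 (- 1) + Gold e0 e1 = Gold a b"
    by (simp add: a_def b_def algebra_simps)
  have "gold_form F (x, y) = Gold (a + 2 * U) (b + 2 * V)"
    by (simp add: F x y a_def b_def U_def V_def algebra_simps)
  then have "a + 2 * U = 0" "b + 2 * V = 0"
    using z val_gold_form[of F x y] by (simp_all add: val_eq_0 del: val.simps)
  moreover have "even U" "even V" if "even c0" "even c1" "even d0" "even d1"
    using that by (simp_all add: U_def V_def)
  ultimately show False using assms(3) unfolding F nonzero_form.simps r
    by (auto, presburger+)
qed

lemma cells_cover:
  assumes "cells_ok y0 y1 cs l'" "cs \<noteq> []" "half_odd x" "half_odd y"
    and "0 < form_value (side y0 y1 (fst (hd cs))) (val x) (val y)"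
    and "form_value (side y0 y1 l') (val x) (val y) < 0"
  shows "\<exists>l r k. cell_ok y0 y1 l r k \<and> 0 < form_value (side y0 y1 l) (val x) (val y) \<and>
    form_value (side y0 y1 r) (val x) (val y) < 0"
  using assms
proof (induction cs)
  case Nil
  then show ?case by simp
next
  case (Cons c cs)
  obtain l k where c: "c = (l, k)" by (cases c)
  let ?v = "\<lambda>l. form_value (side y0 y1 l) (val x) (val y)"
  show ?case
  proof (cases "cs = []")
    case True
    have "cell_ok y0 y1 l l' k" "0 < ?v l"
      using Cons.prems(1,5) c True by (simp_all del: side.simps)
    then show ?thesis using Cons.prems(6) by blast
  next
    case False
    have next_ok: "cells_ok y0 y1 cs l'" using Cons.prems(1) c by simp
    then have "nonzero_form (side y0 y1 (fst (hd cs)))" using False by (cases cs) auto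
    then have "?v (fst (hd cs)) \<noteq> 0" by (rule nonzero_form[OF Cons.prems(3,4)])
    then consider "?v (fst (hd cs)) < 0" | "0 < ?v (fst (hd cs))" by linarith
    then show ?thesis
    proof cases
      case 1
      moreover have "cell_ok y0 y1 l (fst (hd cs)) k" "0 < ?v l"
        using Cons.prems(1,5) c False by (simp_all del: side.simps)
      ultimately show ?thesis by blast
    next
      case 2
      then show ?thesis using Cons.IH next_ok False Cons.prems by blast
    qed
  qed
qed

lemma form_value_side:
  "form_value (side y0 y1 (b, t)) X Y = (val y1 - val y0) * (X - val b) - (val t - val b) * (Y - val y0)"
  by (simp add: form_value_def algebra_simps)

text \<open>The point \<open>(X / (2 phi), Y / 2)\<close> lies in a polygon of the table, up to an integer
translation.\<close>

definition covered :: "real \<Rightarrow> real \<Rightarrow> bool" where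
  "covered X Y \<longleftrightarrow> (\<exists>k ps pm i j. (k, ps, pm) \<in> set polygon_table \<and>
     (X / (2 * phi) - of_int i, Y / 2 - of_int j) \<in> tile ps)"

lemma covered_shift:
  assumes "covered (X - 2 * phi * of_int m) (Y - 2 * of_int n)"
  shows "covered X Y"
proof -
  have phi: "phi > 0" using phi_bounds by simp
  obtain k ps pm i j where *: "(k, ps, pm) \<in> set polygon_table"
    "((X - 2 * phi * of_int m) / (2 * phi) - of_int i, (Y - 2 * of_int n) / 2 - of_int j) \<in> tile ps"
    using assms by (auto simp: covered_def)
  have "(X - 2 * phi * of_int m) / (2 * phi) - of_int i = X / (2 * phi) - of_int (m + i)"
    "(Y - 2 * of_int n) / 2 - of_int j = Y / 2 - of_int (n + j)"
    using phi by (simp_all add: field_simps)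
  then show ?thesis using * unfolding covered_def by metis
qed

text \<open>After a translation by a multiple of \<open>2 * phi\<close> the point lies between the first and the
last line of its slab, and then in one of the cells.\<close>

lemma slab_covered:
  assumes slab: "(y0, y1, cs, l') \<in> set slab_table"
    and x: "half_odd x" and y: "half_odd y" "val y0 < val y" "val y < val y1"
  shows "covered (val x) (val y) \<and> covered (- val x) (- val y)"
proof -
  have phi: "phi > 0" using phi_bounds by simp
  obtain b' t' where l': "l' = (b', t')" by (cases l')
  have ok: "cells_ok y0 y1 cs l'" "cs \<noteq> []" "fst (hd cs) = (b' - Gold 0 2, t' - Gold 0 2)"
    using slab_table_ok slab by (auto simp: list_all_iff slab_ok_def l')
  let ?h = "val y1 - val y0" and ?Y = "val y"
  let ?S = "form_value (side y0 y1 l') (val x) ?Y"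
  have h: "?h * (2 * phi) > 0" using y phi by simp
  define n where "n = \<lfloor>?S / (?h * (2 * phi))\<rfloor> + 1"
  define x' where "x' = x - Gold (2 * 0) (2 * n)"
  have x': "half_odd x'" "val x' = val x - 2 * phi * n"
    using half_odd_shift[OF x, of 0 n] by (simp_all add: x'_def)
  have S': "form_value (side y0 y1 l') (val x') ?Y = ?S - ?h * (2 * phi) * n"
    unfolding l' form_value_side x'(2) by (simp add: algebra_simps)
  have F': "form_value (side y0 y1 (fst (hd cs))) (val x') ?Y = ?S - ?h * (2 * phi) * (n - 1)"
    unfolding l' ok(3) form_value_side x'(2) by (simp add: algebra_simps)
  have "?S / (?h * (2 * phi)) < n" "real_of_int (n - 1) \<le> ?S / (?h * (2 * phi))"
    unfolding n_def by linarith+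
  then have "?S < n * (?h * (2 * phi))" "real_of_int (n - 1) * (?h * (2 * phi)) \<le> ?S"
    by (simp_all only: pos_divide_less_eq[OF h] pos_le_divide_eq[OF h])
  then have "?S < ?h * (2 * phi) * n" "?h * (2 * phi) * (n - 1) \<le> ?S"
    by (simp_all add: mult.commute)
  then have right: "form_value (side y0 y1 l') (val x') ?Y < 0"
    and left: "0 \<le> form_value (side y0 y1 (fst (hd cs))) (val x') ?Y"
    unfolding S' F' by simp_all
  have "nonzero_form (side y0 y1 (fst (hd cs)))" using ok(1,2) by (cases cs) auto
  then have "form_value (side y0 y1 (fst (hd cs))) (val x') ?Y \<noteq> 0"
    by (rule nonzero_form[OF x'(1) y(1)])
  then obtain l r k where cell: "cell_ok y0 y1 l r k"
      "0 < form_value (side y0 y1 l) (val x') ?Y" "form_value (side y0 y1 r) (val x') ?Y < 0"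
    using cells_cover[OF ok(1,2) x'(1) y(1) _ right] left by force
  obtain b t where l: "l = (b, t)" by (cases l)
  obtain b2 t2 where r: "r = (b2, t2)" by (cases r)
  obtain k0 i j where k: "k = (k0, i, j)" by (metis prod.exhaust)
  obtain k' i' j' where opp: "opposite k0 = (k', i', j')" by (metis prod.exhaust)
  let ?zs = "[(b, y0), (t, y1), (b2, y0), (t2, y1)]"
  have enc: "enclosed ?zs (val x') ?Y"
    unfolding enclosed_def
  proof (intro allI impI)
    fix F
    assume *: "\<forall>z\<in>set ?zs. 0 \<le> val (gold_form F z)" "\<exists>z\<in>set ?zs. 0 < val (gold_form F z)"
    show "0 < form_value F (val x') ?Y"
      by (rule form_pos_trapezoid[OF y(2,3) cell(2)[unfolded l form_value_side]
            cell(3)[unfolded r form_value_side]])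
        (use * in \<open>auto simp: val_gold_form\<close>)
  qed
  have "corners_inside (k0, i, j) ?zs"
    "corners_inside (k', i' - i, j' - j) (map (map_prod uminus uminus) ?zs)"
    using cell(1) by (simp_all add: cell_ok_def l r k opp Let_def)
  then have "covered (val x') ?Y" "covered (- val x') (- ?Y)"
    using corners_inside_tile[OF _ enc] corners_inside_tile[OF _ enclosed_uminus[OF enc]]
    unfolding covered_def by blast+
  then show ?thesis
    using covered_shift[of "val x" n ?Y 0] covered_shift[of "- val x" "- n" "- ?Y" 0]
    by (simp add: x'(2))
qed

lemma half_odd_covered:
  assumes x: "half_odd x" and y: "half_odd y"
  shows "covered (val x) (val y)"
proof -
  have half: "covered (val z) (val u) \<and> covered (- val z) (- val u)"
    if z: "half_odd z" and u: "half_odd u" "0 < val u" "val u < val (Gold (- 2) 2)" for z u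
  proof -
    obtain c1 l1 c2 l2 c3 l3 where slabs:
      "(Gold 0 0, Gold (- 6) 4, c1, l1) \<in> set slab_table"
      "(Gold (- 6) 4, Gold 4 (- 2), c2, l2) \<in> set slab_table"
      "(Gold 4 (- 2), Gold (- 2) 2, c3, l3) \<in> set slab_table"
      by (simp add: slab_table_def)
    have "val u \<noteq> val (Gold (- 6) 4)" "val u \<noteq> val (Gold 4 (- 2))"
      by (rule half_odd_val_neq[OF u(1)]; simp)+
    then consider "val u < val (Gold (- 6) 4)"
      | "val (Gold (- 6) 4) < val u" "val u < val (Gold 4 (- 2))"
      | "val (Gold 4 (- 2)) < val u" by linarith
    then show ?thesis
      using slab_covered[OF slabs(1) z u(1)] slab_covered[OF slabs(2) z u(1)]
        slab_covered[OF slabs(3) z u(1)] u by cases auto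
  qed
  define n where "n = \<lfloor>val y / 2\<rfloor>"
  define y' where "y' = y - Gold (2 * n) (2 * 0)"
  have y': "half_odd y'" "val y' = val y - 2 * n"
    using half_odd_shift[OF y, of n 0] by (simp_all add: y'_def)
  have "n \<le> val y / 2" "val y / 2 < n + 1" unfolding n_def by linarith+
  moreover have "val y' \<noteq> val (Gold 0 0)" by (rule half_odd_val_neq[OF y'(1)]) simp
  ultimately have bounds: "0 < val y'" "val y' < 2" using y'(2) by simp_all
  have "covered (val x) (val y')"
  proof (cases "val y' < val (Gold (- 2) 2)")
    case True
    then show ?thesis using half x y' bounds by blast
  next
    case False
    let ?u = "- y' - Gold (2 * (- 1)) (2 * 0)"
    have u: "half_odd ?u" "val ?u = 2 - val y'"
      using half_odd_shift[OF half_odd_uminus[OF y'(1)], of "- 1" 0] by simp_all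
    have "val ?u < val (Gold (- 2) 2)" using False phi_bounds unfolding u(2) by simp
    then have "covered (- val (- x)) (- val ?u)"
      using half[OF half_odd_uminus[OF x] u(1)] bounds u(2) by simp
    then show ?thesis using covered_shift[of "val x" 0 "val y'" 1] by (simp add: u(2))
  qed
  then show ?thesis using covered_shift[of "val x" 0 "val y" n] by (simp add: y'(2))
qed

section \<open>The table and the partition of the torus\<close>

lemma to_plane_corner: "to_plane (corner a) = (case a of (a0, a1, a2, a3) \<Rightarrow> pt a0 a1 a2 a3)"
proof -
  obtain a0 a1 a2 a3 where a: "a = (a0, a1, a2, a3)" by (metis prod.exhaust)
  have "real_of_int a1 * (phi * phi) = a1 * phi + a1" by (simp add: phi_square algebra_simps)
  then have "val (Gold a1 (a0 + a1)) = (a0 + a1 * phi) * phi" by (simp add: algebra_simps)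
  moreover have "phi > 0" using phi_bounds by simp
  ultimately show ?thesis by (simp add: a pt_def del: val.simps) simp
qed

lemma listed_table_polygons:
  "list_all (\<lambda>(k, as, p, m). polygon_vertices k = to_plane ` corner ` set as \<and>
     type_list k = {displacement p, displacement m} - {0} \<and>
     (odd k \<and> k < 24 \<or> k = 24 \<or> k = 26)) listed_table"
  by (simp add: listed_table_def to_plane_corner polygon_vertices_def type_list_def odd_type_def
      zero_prod_def insert_commute del: corner.simps)

lemma type_list_negated:
  assumes "odd k \<and> k < 23 \<or> k = 24"
  shows "type_list (k + 1) = uminus ` type_list k"
proof (cases "k = 24")
  case False
  then have k: "odd k" "k < 23" using assms by auto
  then have "k + 1 \<le> 22" "2 \<le> k + 1" by presburger+
  then show ?thesis using k by (simp add: type_list_def)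
qed (simp add: type_list_def odd_type_def)

lemma displacement_mirror:
  "displacement (map_prod mirror mirror p) = - displacement p"
  by (cases p rule: displacement.cases) simp

lemma interior_hull_uminus:
  fixes S :: "plane set"
  shows "interior (convex hull (uminus ` S)) = uminus ` interior (convex hull S)"
  by (simp add: convex_hull_linear_image[symmetric] interior_negations linear_uminus)

lemma proj_uminus: "proj (- z) = - proj z"
  by (simp add: uminus_torus.abs_eq)

lemma polygon_table_polygons:
  assumes "(k, ps, p, m) \<in> set polygon_table"
  shows "polygon k = proj ` tile ps" and "type_list k = {displacement p, displacement m} - {0}"
proof -
  obtain k0 as p0 m0 where row: "(k0, as, p0, m0) \<in> set listed_table"
    and cases: "k = k0 \<and> ps = map corner as \<and> p = p0 \<and> m = m0 \<or>
      k0 \<notin> {23, 26} \<and> k = k0 + 1 \<and> ps = map (map_prod uminus uminus \<circ> corner) as \<and>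
      p = map_prod mirror mirror p0 \<and> m = map_prod mirror mirror m0"
    using assms unfolding polygon_table_def by (auto split: if_splits)
  have vertices: "polygon_vertices k0 = to_plane ` corner ` set as"
    and types: "type_list k0 = {displacement p0, displacement m0} - {0}"
    and k0: "odd k0 \<and> k0 < 24 \<or> k0 = 24 \<or> k0 = 26"
    using bspec[OF listed_table_polygons[unfolded list_all_iff] row] by (simp_all only: prod.case)
  have listed: "listed_polygon k0 = proj ` tile (map corner as)"
    by (simp add: listed_polygon_def tile_def vertices)
  from cases show "polygon k = proj ` tile ps"
  proof
    assume "k = k0 \<and> ps = map corner as \<and> p = p0 \<and> m = m0"
    moreover have "polygon k0 = listed_polygon k0" using k0 by (auto simp: polygon_def)
    ultimately show ?thesis using listed by simp
  next
    assume *: "k0 \<notin> {23, 26} \<and> k = k0 + 1 \<and> ps = map (map_prod uminus uminus \<circ> corner) as \<and>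
      p = map_prod mirror mirror p0 \<and> m = map_prod mirror mirror m0"
    have neg: "to_plane (map_prod uminus uminus z) = - to_plane z" for z by (cases z) simp
    have "tile ps = uminus ` tile (map corner as)"
      using * by (simp add: tile_def image_image neg flip: interior_hull_uminus)
    moreover have "even k \<and> 2 \<le> k \<and> k \<le> 22 \<or> k = 25" "k - 1 = k0"
      using k0 * by (auto, presburger+)
    then have "polygon k = uminus ` listed_polygon k0"
      by (simp only: polygon_def if_True)
    ultimately show ?thesis unfolding listed by (simp add: image_image proj_uminus)
  qed
  from cases show "type_list k = {displacement p, displacement m} - {0}"
  proof
    assume *: "k0 \<notin> {23, 26} \<and> k = k0 + 1 \<and> ps = map (map_prod uminus uminus \<circ> corner) as \<and>
      p = map_prod mirror mirror p0 \<and> m = map_prod mirror mirror m0"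
    then have "k0 \<noteq> 23" "k0 \<noteq> 26" by simp_all
    then have "odd k0 \<and> k0 < 23 \<or> k0 = 24" using k0 by presburger
    then have "type_list k = uminus ` ({displacement p0, displacement m0} - {0})"
      using type_list_negated * types by simp
    also have "\<dots> = {displacement p, displacement m} - {0}"
      using * by (simp add: displacement_mirror image_set_diff[OF inj_uminus])
    finally show ?thesis .
  qed (simp add: types)
qed

lemma Psi_in_polygon:
  assumes "(k, ps, p, m) \<in> set polygon_table"
  shows "Psi x \<in> polygon k \<longleftrightarrow>
    (\<exists>i j. (T_map x / (2 * phi) - of_int i, T_map x / 2 - of_int j) \<in> tile ps)"
proof -
  let ?z = "(T_map x / (2 * phi), T_map x / 2)"
  have "Psi x \<in> polygon k \<longleftrightarrow> (\<exists>w\<in>tile ps. ?z - w \<in> lattice)"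
    by (simp only: Psi_def polygon_table_polygons(1)[OF assms] image_iff torus.abs_eq_iff)
  also have "\<dots> \<longleftrightarrow> (\<exists>i j. ?z - (of_int i, of_int j) \<in> tile ps)"
  proof
    assume "\<exists>w\<in>tile ps. ?z - w \<in> lattice"
    then obtain w i j where w: "w \<in> tile ps" "?z - w = (of_int i, of_int j)"
      unfolding lattice_iff by blast
    have "?z - (of_int i, of_int j) = w" unfolding w(2)[symmetric] by simp
    then show "\<exists>i j. ?z - (of_int i, of_int j) \<in> tile ps" using w(1) by metis
  next
    assume "\<exists>i j. ?z - (of_int i, of_int j) \<in> tile ps"
    then obtain i j where w: "?z - (of_int i, of_int j) \<in> tile ps" by blast
    have "?z - (?z - (of_int i, of_int j)) \<in> lattice" by (simp add: lattice_def)
    then show "\<exists>w\<in>tile ps. ?z - w \<in> lattice" using w by blast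
  qed
  finally show ?thesis by simp
qed

text \<open>The heights of \<open>t\<close> and of its representative \<open>Y\<close> differ by
\<open>2 * j\<close>. For odd \<open>j\<close> this exchanges the two classes modulo 4, hence the two
pairs of itineraries.\<close>

lemma trips_on_row:
  assumes "(k, ps, p, m) \<in> set polygon_table"
    and "(t / (2 * phi) - of_int i, t / 2 - of_int j) \<in> tile ps"
  defines "s \<equiv> map_prod (shift i j) (shift i j)"
  shows "trip t 1 (s (if even j then p else m))" and "trip t (- 1) (s (if even j then m else p))"
proof -
  have "pair_fits 1 p ps" "pair_fits (- 1) m ps"
    using polygon_table_fits assms(1) by (auto simp: list_all_iff)
  then show "trip t 1 (s (if even j then p else m))" "trip t (- 1) (s (if even j then m else p))"
    unfolding s_def using trip_on_tile[OF _ _ _ assms(2)] by auto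
qed

lemma signature_shift:
  "signature (map_prod (shift i j) (shift i j) p, map_prod (shift i j) (shift i j) m) = signature (p, m)"
proof -
  have "normalised (shift i j b) (shift i j c) = normalised b c" for b c
    by (cases b; cases c) simp
  then show ?thesis by (simp add: signature_def split_def)
qed

lemma distinct_concat_map:
  "distinct (concat (map f xs)) \<Longrightarrow> x \<in> set xs \<Longrightarrow> y \<in> set xs \<Longrightarrow>
   z \<in> set (f x) \<Longrightarrow> z \<in> set (f y) \<Longrightarrow> x = y"
  by (induction xs) auto

text \<open>The integers that describe the two half trips of \<open>t\<close> do not depend on the polygon
through which they were found, so the two rows have a common signature.\<close>

lemma row_unique:
  assumes r: "(k, ps, p, m) \<in> set polygon_table"
      "(t / (2 * phi) - of_int i, t / 2 - of_int j) \<in> tile ps"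
    and r': "(k', ps', p', m') \<in> set polygon_table"
      "(t / (2 * phi) - of_int i', t / 2 - of_int j') \<in> tile ps'"
  shows "k = k'"
proof -
  let ?q = "(if even j then p else m, if even j then m else p)"
  let ?q' = "(if even j' then p' else m', if even j' then m' else p')"
  have "map_prod (shift i j) (shift i j) (fst ?q) = map_prod (shift i' j') (shift i' j') (fst ?q')"
    "map_prod (shift i j) (shift i j) (snd ?q) = map_prod (shift i' j') (shift i' j') (snd ?q')"
    using trips_on_row[OF r] trips_on_row[OF r'] trip_unique by (metis fst_conv snd_conv)+
  then have "signature ?q = signature ?q'"
    using signature_shift[of i j "fst ?q" "snd ?q"] signature_shift[of i' j' "fst ?q'" "snd ?q'"] by simp
  moreover have "signature ?q \<in> set [signature (p, m), signature (m, p)]"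
    "signature ?q' \<in> set [signature (p', m'), signature (m', p')]" by auto
  ultimately have "(k, ps, p, m) = (k', ps', p', m')"
    using distinct_concat_map[OF signatures_distinct r(1) r'(1), of "signature ?q"] by simp
  then show ?thesis by simp
qed

lemma polygon_table_index: "k \<in> {1..26} \<longleftrightarrow> (\<exists>ps p m. (k, ps, p, m) \<in> set polygon_table)"
proof -
  have "set (map fst polygon_table) = set [1..<27]"
    using polygon_table_indices by (rule mset_eq_setD)
  also have "\<dots> = {1..26}" by auto
  finally have *: "{1..26} = set (map fst polygon_table)" ..
  show ?thesis unfolding * by force
qed

lemma exists_polygon:
  assumes "x \<in> lattice"
  shows "\<exists>k\<in>{1..26}. Psi x \<in> polygon k"
proof -
  obtain a b where x: "x = (of_int a, of_int b)" using assms unfolding lattice_iff by blast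
  let ?g = "Gold (2 - 6 * a + 2 * b) (4 * a - 1)"
  have "?g = Gold (2 + 2 * (b - 3 * a)) (2 * (2 * a) - 1)" by simp
  then have "half_odd ?g" unfolding half_odd_def by blast
  then have "covered (T_map x) (T_map x)" unfolding x T_map_val by (intro half_odd_covered)
  then obtain k ps p m i j where row: "(k, ps, p, m) \<in> set polygon_table"
      "(T_map x / (2 * phi) - of_int i, T_map x / 2 - of_int j) \<in> tile ps"
    unfolding covered_def by (metis prod.exhaust)
  then have "Psi x \<in> polygon k" using Psi_in_polygon[OF row(1)] by blast
  then show ?thesis using row(1) polygon_table_index by blast
qed

lemma unique_polygon:
  assumes "k \<in> {1..26}" "Psi x \<in> polygon k" "k' \<in> {1..26}" "Psi x \<in> polygon k'"
  shows "k = k'"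
proof -
  obtain ps p m where r: "(k, ps, p, m) \<in> set polygon_table"
    using assms(1) polygon_table_index by blast
  obtain ps' p' m' where r': "(k', ps', p', m') \<in> set polygon_table"
    using assms(3) polygon_table_index by blast
  show ?thesis
    using assms(2,4) row_unique[OF r _ r'] unfolding Psi_in_polygon[OF r] Psi_in_polygon[OF r'] by blast
qed

lemma local_type_polygon:
  assumes x: "x \<in> lattice \<inter> H" and k: "k \<in> {1..26}" "Psi x \<in> polygon k"
  shows "local_type x = type_list k"
proof -
  obtain ps p m where row: "(k, ps, p, m) \<in> set polygon_table"
    using k(1) polygon_table_index by blast
  then obtain i j where w: "(T_map x / (2 * phi) - of_int i, T_map x / 2 - of_int j) \<in> tile ps"
    using k(2) Psi_in_polygon by blast
  have "local_type x = {displacement (if even j then p else m), displacement (if even j then m else p)} - {0}"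
    using local_type_trips[OF x trips_on_row[OF row w]] unfolding displacement_shift .
  also have "\<dots> = {displacement p, displacement m} - {0}" by auto
  also have "\<dots> = type_list k" using polygon_table_polygons(2)[OF row] ..
  finally show ?thesis .
qed

theorem lemma2p2:
  shows "(\<forall>x \<in> lattice \<inter> H.
            (\<exists>!k. k \<in> {1..26} \<and> Psi x \<in> polygon k) \<and>
            (\<forall>k \<in> {1..26}. Psi x \<in> polygon k \<longrightarrow> local_type x = type_list k)) \<and>
         (\<forall>x \<in> lattice \<inter> H. \<forall>\<tau>.
            local_type x = \<tau> \<longleftrightarrow>
              (\<exists>k \<in> {1..26}. Psi x \<in> polygon k \<and> type_list k = \<tau>))"
proof (intro conjI ballI allI)
  fix x assume x: "x \<in> lattice \<inter> H"
  then show "\<exists>!k. k \<in> {1..26} \<and> Psi x \<in> polygon k"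
    using exists_polygon unique_polygon by blast
next
  fix x and k :: nat assume "x \<in> lattice \<inter> H" "k \<in> {1..26}"
  then show "Psi x \<in> polygon k \<longrightarrow> local_type x = type_list k" using local_type_polygon by blast
next
  fix x \<tau> assume x: "x \<in> lattice \<inter> H"
  then show "local_type x = \<tau> \<longleftrightarrow> (\<exists>k \<in> {1..26}. Psi x \<in> polygon k \<and> type_list k = \<tau>)"
    using exists_polygon local_type_polygon by blast
qed

end
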